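(* Assume the Green's functions $G_N[2T]$, $G_N[T]$, $G_{M_1}[T]$ exist. Let $\sigma_1,\sigma_2\in L^1(I)$, let $u_N$ be the unique solution of $Lu=\sigma_1$ a.e. on $I$, $u\in X_{N,T}$, and $u_{M_1}$ the unique solution of $Lu=\sigma_2$ a.e. on $I$, $u\in X_{M_1,T}$. Then: 1. If $G_N[2T]\ge0$ on $J\times J$ and $|\sigma_2(t)|\le\sigma_1(t)$ for a.e. $t\in I$, then $|u_{M_1}(t)|\le u_N(t)$ for all $t\in I$. 2. If $G_N[2T]\le0$ on $J\times J$ and $0\le\sigma_2(t)\le\sigma_1(t)$ for a.e. $t\in I$, then $u_N(t)\le0$ and $u_N(t)\le u_{M_1}(t)$ for all $t\in I$. 3. If $G_N[2T]\le0$ on $J\times J$ and $\sigma_1(t)\le\sigma_2(t)\le0$ for a.e. $t\in I$, then $u_N(t)\ge0$ and $u_{M_1}(t)\le u_N(t)$ for all $t\in I$.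
   Context: Fix $n\ge 1$, $T>0$, $I=[0,T]$, $J=[0,2T]$. $W^{2n,1}(K)$: $u\in C^{2n-1}(K)$ with $u^{(2n-1)}$ absolutely continuous. Let $a_0,\dots,a_{2n-1}\in L^\alpha(I)$, $\alpha\ge1$, $Lu=u^{(2n)}+\sum_{k=0}^{2n-1}a_ku^{(k)}$ on $I$. $\widetilde L u=u^{(2n)}+\sum_{k=0}^{n-1}(\hat a_{2k+1}u^{(2k+1)}+\tilde a_{2k}u^{(2k)})$ on $J$, where $\tilde a_{2k}=a_{2k}$, $\hat a_{2k+1}=a_{2k+1}$ on $I$, and $\tilde a_{2k}(t)=a_{2k}(2T-t)$, $\hat a_{2k+1}(t)=-a_{2k+1}(2T-t)$ for $t\in(T,2T]$. An operator $M$ is nonresonant in $X$ if $Mu=0$ a.e., $u\in X$ forces $u\equiv0$; its Green's function $G$ then gives the unique solution $u(t)=\int G(t,s)\sigma(s)ds$ of $Mu=\sigma$, $u\in X$. $X_{N,T}=\{u\in W^{2n,1}(I): u^{(2k+1)}(0)=u^{(2k+1)}(T)=0,\ k=0,\dots,n-1\}$ and $X_{M_1,T}=\{u\in W^{2n,1}(I): u^{(2k+1)}(0)=u^{(2k)}(T)=0,\ k=0,\dots,n-1\}$; $G_N[T]$, $G_{M_1}[T]$ are the Green's functions of $L$ on these spaces. $G_N[2T]$: Green's function of $\widetilde L$ on $\{u\in W^{2n,1}(J): u^{(2k+1)}(0)=u^{(2k+1)}(2T)=0,\ k=0,\dots,n-1\}$. *)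

theory Defs
  imports "HOL-Analysis.Analysis"
begin

fun hderiv :: "real set \<Rightarrow> nat \<Rightarrow> (real \<Rightarrow> real) \<Rightarrow> real \<Rightarrow> real" where
  "hderiv K 0 u = u"
| "hderiv K (Suc k) u = (\<lambda>t. vector_derivative (hderiv K k u) (at t within K))"

definition abs_cont_on :: "real set \<Rightarrow> (real \<Rightarrow> real) \<Rightarrow> bool" where
  "abs_cont_on K f \<longleftrightarrow>
     (\<forall>e>0. \<exists>d>0. \<forall>(N::nat) (a::nat \<Rightarrow> real) b.
        (\<forall>i<N. a i \<le> b i \<and> {a i..b i} \<subseteq> K) \<and>
        (\<forall>i<N. \<forall>j<N. i \<noteq> j \<longrightarrow> b i \<le> a j \<or> b j \<le> a i) \<and>
        (\<Sum>i<N. b i - a i) < d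
        \<longrightarrow> (\<Sum>i<N. \<bar>f (b i) - f (a i)\<bar>) < e)"

text \<open>W^{m,1}(K): u in C^{m-1}(K) with u^{(m-1)} absolutely continuous (here m = 2n).\<close>
definition Wsp :: "nat \<Rightarrow> real set \<Rightarrow> (real \<Rightarrow> real) \<Rightarrow> bool" where
  "Wsp m K u \<longleftrightarrow>
     (\<forall>k. Suc k < m \<longrightarrow> (\<forall>t\<in>K.
         (hderiv K k u has_vector_derivative hderiv K (Suc k) u t) (at t within K))) \<and>
     (\<forall>k<m. continuous_on K (hderiv K k u)) \<and>
     abs_cont_on K (hderiv K (m - 1) u)"

definition Lop :: "nat \<Rightarrow> (nat \<Rightarrow> real \<Rightarrow> real) \<Rightarrow> real set \<Rightarrow> (real \<Rightarrow> real) \<Rightarrow> real \<Rightarrow> real" where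
  "Lop m a K u t = hderiv K m u t + (\<Sum>k<m. a k t * hderiv K k u t)"

definition solves_ae :: "nat \<Rightarrow> (nat \<Rightarrow> real \<Rightarrow> real) \<Rightarrow> real set \<Rightarrow> (real \<Rightarrow> real) \<Rightarrow> (real \<Rightarrow> real) \<Rightarrow> bool" where
  "solves_ae m a K \<sigma> u \<longleftrightarrow> (AE t in lebesgue. t \<in> K \<longrightarrow> Lop m a K u t = \<sigma> t)"

definition XN :: "nat \<Rightarrow> real \<Rightarrow> (real \<Rightarrow> real) \<Rightarrow> bool" where
  "XN m T u \<longleftrightarrow> Wsp m {0..T} u \<and>
     (\<forall>k < m div 2. hderiv {0..T} (2*k+1) u 0 = 0 \<and> hderiv {0..T} (2*k+1) u T = 0)"

definition XM1 :: "nat \<Rightarrow> real \<Rightarrow> (real \<Rightarrow> real) \<Rightarrow> bool" where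
  "XM1 m T u \<longleftrightarrow> Wsp m {0..T} u \<and>
     (\<forall>k < m div 2. hderiv {0..T} (2*k+1) u 0 = 0 \<and> hderiv {0..T} (2*k) u T = 0)"

definition nonresonant :: "nat \<Rightarrow> (nat \<Rightarrow> real \<Rightarrow> real) \<Rightarrow> real set \<Rightarrow> ((real \<Rightarrow> real) \<Rightarrow> bool) \<Rightarrow> bool" where
  "nonresonant m a K X \<longleftrightarrow>
     (\<forall>u. X u \<and> solves_ae m a K (\<lambda>_. 0) u \<longrightarrow> (\<forall>t\<in>K. u t = 0))"

definition green_function :: "nat \<Rightarrow> (nat \<Rightarrow> real \<Rightarrow> real) \<Rightarrow> real set \<Rightarrow> ((real \<Rightarrow> real) \<Rightarrow> bool)
    \<Rightarrow> (real \<Rightarrow> real \<Rightarrow> real) \<Rightarrow> bool" where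
  "green_function m a K X G \<longleftrightarrow> nonresonant m a K X \<and>
     (\<forall>\<sigma>. \<sigma> absolutely_integrable_on K \<longrightarrow>
        (\<forall>t\<in>K. (\<lambda>s. G t s * \<sigma> s) integrable_on K) \<and>
        X (\<lambda>t. integral K (\<lambda>s. G t s * \<sigma> s)) \<and>
        solves_ae m a K \<sigma> (\<lambda>t. integral K (\<lambda>s. G t s * \<sigma> s)))"

definition refl_coeff :: "real \<Rightarrow> (nat \<Rightarrow> real \<Rightarrow> real) \<Rightarrow> nat \<Rightarrow> real \<Rightarrow> real" where
  "refl_coeff T a k t = (if t \<le> T then a k t else (-1)^k * a k (2*T - t))"

definition in_Lp :: "real \<Rightarrow> real set \<Rightarrow> (real \<Rightarrow> real) \<Rightarrow> bool" where
  "in_Lp p K f \<longleftrightarrow> f measurable_on K \<and> (\<lambda>t. \<bar>f t\<bar> powr p) integrable_on K"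

end

theory Submission
  imports Defs
begin

text \<open>Extend \<open>uN\<close> evenly and \<open>uM\<close> oddly about \<open>T\<close>. By the boundary conditions at \<open>T\<close> both extensions
  keep their regularity; they satisfy the Neumann conditions on \<open>[0, 2T]\<close> and solve the reflected
  equation with the even extension of \<open>\<sigma>1\<close> and the odd extension of \<open>\<sigma>2\<close> as right-hand sides. Hence
  both are represented by \<open>G2\<close>, and the assumptions on \<open>\<sigma>1\<close>, \<open>\<sigma>2\<close> compare the two integrands.

  The representation rests on uniqueness, which subtracts two solutions. Since \<open>hderiv\<close> takes a junk
  value wherever a derivative does not exist, this needs Lebesgue's theorem that an absolutely continuous
  function is differentiable almost everywhere. For functions of bounded variation it follows
  from Botsko's folding argument and Vitali's covering theorem.\<close>

section \<open>Functions of bounded variation are differentiable almost everywhere\<close>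

text \<open>Some arbitrarily short intervals around \<open>x\<close> have slope at least \<open>c\<close>: up to the boundary case, an
  upper derivate of \<open>g\<close> at \<open>x\<close> is at least \<open>c\<close>, and \<open>steep_at (- c) (- g)\<close> says that a lower derivate
  is at most \<open>c\<close>.\<close>

definition steep_at :: "real \<Rightarrow> (real \<Rightarrow> real) \<Rightarrow> real \<Rightarrow> bool" where
  "steep_at c g x \<longleftrightarrow>
     (\<forall>d>0. \<exists>u v. u \<le> x \<and> x \<le> v \<and> u < v \<and> v - u < d \<and> c * (v - u) \<le> g v - g u)"

text \<open>Steepness tests only intervals of arbitrarily small length, so it suffices to compare
  increments on a neighbourhood of \<open>x\<close>. This carries steepness from \<open>f\<close> to
  linear corrections of it, to \<open>V\<close> and to \<open>V - h\<close>.\<close>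

lemma steep_at_local:
  assumes "steep_at c g x" "r > 0"
    and "\<And>u v. x - r \<le> u \<Longrightarrow> u \<le> x \<Longrightarrow> x \<le> v \<Longrightarrow> v \<le> x + r \<Longrightarrow> c * (v - u) \<le> g v - g u
           \<Longrightarrow> c' * (v - u) \<le> g' v - g' u"
  shows "steep_at c' g' x"
  unfolding steep_at_def
proof (intro allI impI)
  fix d :: real assume "d > 0"
  then have "min d r > 0" using assms by simp
  then obtain u v where uv: "u \<le> x" "x \<le> v" "u < v" "v - u < min d r" "c * (v - u) \<le> g v - g u"
    using assms(1) unfolding steep_at_def by blast
  then have "c' * (v - u) \<le> g' v - g' u" by (intro assms(3)) auto
  with uv show "\<exists>u v. u \<le> x \<and> x \<le> v \<and> u < v \<and> v - u < d \<and> c' * (v - u) \<le> g' v - g' u"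
    by auto
qed

section \<open>Outer measure of the steep set of a monotone function\<close>

text \<open>The induction inserts the interval \<open>{u..v}\<close> with the largest left endpoint.
  Disjointness forces all earlier intervals to end before \<open>u\<close>, so the induction
  hypothesis applies with \<open>u\<close> in place of \<open>b\<close>.\<close>

lemma sum_increments_le:
  fixes g :: "real \<Rightarrow> real"
  assumes "finite C" "mono_on {a..b} g" "a \<le> b"
    and "\<And>u v. (u, v) \<in> C \<Longrightarrow> a \<le> u \<and> u \<le> v \<and> v \<le> b"
    and "pairwise (\<lambda>(u, v) (u', v'). disjnt {u..v} {u'..v'}) C"
  shows "(\<Sum>(u, v)\<in>C. g v - g u) \<le> g b - g a"
  using assms
proof (induction C arbitrary: b rule: finite_ranking_induct[where f = fst])
  case empty
  then show ?case by (auto simp: mono_on_def)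
next
  case (insert q S)
  show ?case
  proof (cases "q \<in> S")
    case True
    then show ?thesis using insert by (simp add: insert_absorb)
  next
    case False
    obtain u v where q: "q = (u, v)" by (cases q)
    have uv: "a \<le> u" "u \<le> v" "v \<le> b" using insert.prems(3) q by auto
    have "v' \<le> u" if "(u', v') \<in> S" for u' v'
    proof -
      have "disjnt {u..v} {u'..v'}" using insert.prems(4) that q False
        by (auto simp: pairwise_def)
      moreover have "u' \<le> u" using insert.hyps(2)[OF that] q by simp
      ultimately show ?thesis using uv unfolding disjnt_iff by force
    qed
    moreover have "mono_on {a..u} g" using insert.prems(1) uv by (auto simp: mono_on_def)
    ultimately have "(\<Sum>(u, v)\<in>S. g v - g u) \<le> g u - g a"
      using insert.prems uv by (intro insert.IH) (auto simp: pairwise_insert)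
    moreover have "g v \<le> g b" using insert.prems(1) uv by (auto simp: mono_on_def)
    ultimately show ?thesis using False q insert.hyps(1) by simp
  qed
qed

text \<open>The short steep intervals form a Vitali cover of \<open>E\<close>, so countably many
  disjoint ones cover \<open>E\<close> up to a null set. Each is at most 1 / \<open>c\<close> times
  as long as the increment of \<open>g\<close> over it, and disjoint increments add up to at most
  \<open>g b - g a\<close>. Measurability of \<open>E\<close> is not assumed, hence the measurable
  superset \<open>T\<close>.\<close>

lemma steep_set_outer_measure:
  fixes g :: "real \<Rightarrow> real"
  assumes g: "mono_on {a..b} g" and ab: "a \<le> b" and c: "c > 0"
    and E: "\<And>x. x \<in> E \<Longrightarrow> a < x \<and> x < b \<and> steep_at c g x"
  obtains T where "E \<subseteq> T" "T \<in> lmeasurable" "measure lebesgue T \<le> (g b - g a) / c"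
proof -
  define K where "K = {(u, v). a \<le> u \<and> u < v \<and> v \<le> b \<and> c * (v - u) \<le> g v - g u}"
  define ce where "ce = (\<lambda>(u, v). (u + v) / 2 :: real)"
  define ra where "ra = (\<lambda>(u, v). (v - u) / 2 :: real)"
  have cb: "cball (ce q) (ra q) = {fst q..snd q}" for q
    by (auto simp: ce_def ra_def cball_eq_atLeastAtMost field_simps split: prod.splits)
  obtain C where C: "countable C" "C \<subseteq> K"
    and disj: "pairwise (\<lambda>i j. disjnt (cball (ce i) (ra i)) (cball (ce j) (ra j))) C"
    and neg: "negligible (E - (\<Union>i\<in>C. cball (ce i) (ra i)))"
  proof (rule Vitali_covering_theorem_cballs[of K ra E ce])
    show "0 < ra i" if "i \<in> K" for i
      using that by (auto simp: K_def ra_def)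
    show "\<exists>i. i \<in> K \<and> x \<in> cball (ce i) (ra i) \<and> ra i < d" if "x \<in> E" "0 < d" for x d
    proof -
      have "min d (min (x - a) (b - x)) > 0" "steep_at c g x" using E[OF that(1)] that by auto
      then obtain u v where "u \<le> x" "x \<le> v" "u < v" "v - u < min d (min (x - a) (b - x))"
        "c * (v - u) \<le> g v - g u"
        unfolding steep_at_def by blast
      then have "(u, v) \<in> K" "x \<in> cball (ce (u, v)) (ra (u, v))" "ra (u, v) < d"
        unfolding cb by (auto simp: K_def ra_def)
      then show ?thesis by blast
    qed
  qed blast
  let ?U = "\<Union>i\<in>C. cball (ce i) (ra i)"
  \<comment> \<open>The bound does not depend on the finite subfamily, so it passes to the countable
    union.\<close>
  have fin: "measure lebesgue (\<Union>i\<in>I. cball (ce i) (ra i)) \<le> (g b - g a) / c"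
    if I: "I \<subseteq> C" "finite I" for I
  proof -
    have "measure lebesgue (\<Union>i\<in>I. cball (ce i) (ra i))
        \<le> (\<Sum>i\<in>I. measure lebesgue (cball (ce i) (ra i)))"
      using I by (intro measure_UNION_le) auto
    also have "\<dots> \<le> (\<Sum>(u, v)\<in>I. (g v - g u) / c)"
      using I C c unfolding cb
      by (intro sum_mono) (auto simp: K_def field_simps dest!: subsetD)
    also have "\<dots> = (\<Sum>(u, v)\<in>I. g v - g u) / c"
      by (simp add: sum_divide_distrib case_prod_unfold)
    also have "\<dots> \<le> (g b - g a) / c"
    proof (intro divide_right_mono sum_increments_le)
      show "pairwise (\<lambda>(u, v) (u', v'). disjnt {u..v} {u'..v'}) I"
        using pairwise_subset[OF disj I(1)] unfolding cb by (simp add: case_prod_unfold)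
      show "a \<le> u \<and> u \<le> v \<and> v \<le> b" if "(u, v) \<in> I" for u v
        using that I C by (auto simp: K_def)
    qed (use I g c ab in auto)
    finally show ?thesis .
  qed
  have U: "?U \<in> lmeasurable" "measure lebesgue ?U \<le> (g b - g a) / c"
    by (rule fmeasurable_UN_bound[OF C(1) _ fin] measure_UN_bound[OF C(1) _ fin]; simp)+
  let ?T = "?U \<union> (E - ?U)"
  show ?thesis
  proof
    show "E \<subseteq> ?T" by blast
    show "?T \<in> lmeasurable"
      by (rule fmeasurable.Un[OF U(1) negligible_imp_measurable[OF neg]])
    have "measure lebesgue ?T \<le> measure lebesgue ?U + measure lebesgue (E - ?U)"
      by (rule measure_Un_le[OF fmeasurableD[OF U(1)] negligible_imp_sets[OF neg]])
    then show "measure lebesgue ?T \<le> (g b - g a) / c"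
      using U negligible_imp_measure0[OF neg] by simp
  qed
qed

section \<open>Variation and folding\<close>

text \<open>Partitions are monotone sequences read up to the index \<open>N\<close>, with repeated
  points allowed. For \<open>b < a\<close> there are none and the property is vacuous, which is why
  later proofs split on \<open>a \<le> b\<close>.\<close>

definition variation_bounded :: "real \<Rightarrow> real \<Rightarrow> (real \<Rightarrow> real) \<Rightarrow> bool" where
  "variation_bounded a b f \<longleftrightarrow>
     (\<exists>B. \<forall>p N. mono p \<and> p 0 = a \<and> p N = b \<longrightarrow> (\<Sum>i<N. \<bar>f (p (Suc i)) - f (p i)\<bar>) \<le> B)"

lemma sum_increments_extend_partition:
  fixes f :: "real \<Rightarrow> real"
  assumes "mono p" "p 0 = a" "p N = x" "x \<le> y"
  obtains q where "mono q" "q 0 = a" "q (Suc N) = y"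
    "(\<Sum>i<Suc N. \<bar>f (q (Suc i)) - f (q i)\<bar>) = (\<Sum>i<N. \<bar>f (p (Suc i)) - f (p i)\<bar>) + \<bar>f y - f x\<bar>"
proof
  let ?q = "\<lambda>i. if i \<le> N then p i else y"
  show "mono ?q"
  proof (rule monoI)
    fix i j :: nat assume "i \<le> j"
    moreover have "p i \<le> p j" "i \<le> N \<Longrightarrow> p i \<le> p N"
      using assms(1) \<open>i \<le> j\<close> by (auto simp: mono_def)
    ultimately show "?q i \<le> ?q j" using assms(3,4) by auto
  qed
  show "?q 0 = a" "?q (Suc N) = y" using assms by auto
  show "(\<Sum>i<Suc N. \<bar>f (?q (Suc i)) - f (?q i)\<bar>) = (\<Sum>i<N. \<bar>f (p (Suc i)) - f (p i)\<bar>) + \<bar>f y - f x\<bar>"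
    using assms by simp
qed

text \<open>\<open>V x\<close> is the supremum of the partition sums on \<open>{a..x}\<close>.
  Appending \<open>y\<close> to a partition ending in \<open>x\<close> gives the first property, and
  approximating the supremum at \<open>b\<close> gives the second.\<close>

lemma variation_function:
  assumes f: "variation_bounded a b f" and ab: "a \<le> b"
  obtains V where "\<And>x y. a \<le> x \<Longrightarrow> x \<le> y \<Longrightarrow> y \<le> b \<Longrightarrow> \<bar>f y - f x\<bar> \<le> V y - V x"
    and "\<And>e. e > 0 \<Longrightarrow> \<exists>p N. mono p \<and> p 0 = a \<and> p N = b \<and>
            V b - V a \<le> (\<Sum>i<N. \<bar>f (p (Suc i)) - f (p i)\<bar>) + e"
proof -
  define S where "S x = {\<Sum>i<N. \<bar>f (p (Suc i)) - f (p i)\<bar> | p N. mono p \<and> p 0 = a \<and> p N = x}" for x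
  define V where "V x = Sup (S x)" for x
  have ext: "\<exists>t\<in>S y. t = s + \<bar>f y - f x\<bar>" if s: "s \<in> S x" and "x \<le> y" for s x y
  proof -
    obtain p N where p: "mono p" "p 0 = a" "p N = x" "s = (\<Sum>i<N. \<bar>f (p (Suc i)) - f (p i)\<bar>)"
      using s unfolding S_def by blast
    obtain q where q: "mono q" "q 0 = a" "q (Suc N) = y"
      "(\<Sum>i<Suc N. \<bar>f (q (Suc i)) - f (q i)\<bar>) = s + \<bar>f y - f x\<bar>"
      using sum_increments_extend_partition[OF p(1-3) \<open>x \<le> y\<close>, of f] unfolding p(4) .
    then have "s + \<bar>f y - f x\<bar> \<in> S y"
      unfolding S_def by (intro CollectI exI[of _ q] exI[of _ "Suc N"]) simp
    then show ?thesis by blast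
  qed
  \<comment> \<open>The partition with \<open>N = 0\<close> makes every \<open>S x\<close> nonempty
    by extension, and it yields \<open>V a \<ge> 0\<close>, which is all that the near-optimality
    claim needs about \<open>V a\<close>.\<close>
  have S0: "0 \<in> S a"
    unfolding S_def by (rule CollectI, rule exI[of _ "\<lambda>_. a"], rule exI[of _ 0]) (auto simp: mono_def)
  have ne: "S x \<noteq> {}" if "a \<le> x" for x using ext[OF S0 that] by blast
  obtain B where B: "s \<le> B" if "s \<in> S b" for s
    using f unfolding variation_bounded_def S_def by blast
  have bdd: "bdd_above (S x)" if "x \<le> b" for x
  proof (rule bdd_aboveI[of _ B])
    fix s assume "s \<in> S x"
    from ext[OF this that] B show "s \<le> B" by fastforce
  qed
  show ?thesis
  proof
    show "\<bar>f y - f x\<bar> \<le> V y - V x" if "a \<le> x" "x \<le> y" "y \<le> b" for x y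
    proof -
      have "V x \<le> V y - \<bar>f y - f x\<bar>"
        unfolding V_def
      proof (rule cSup_least[OF ne[OF that(1)]])
        fix s assume "s \<in> S x"
        from ext[OF this that(2)] have "s + \<bar>f y - f x\<bar> \<in> S y" by blast
        then have "s + \<bar>f y - f x\<bar> \<le> Sup (S y)" using bdd[OF that(3)] by (rule cSup_upper)
        then show "s \<le> Sup (S y) - \<bar>f y - f x\<bar>" by simp
      qed
      then show ?thesis by simp
    qed
    show "\<exists>p N. mono p \<and> p 0 = a \<and> p N = b \<and>
            V b - V a \<le> (\<Sum>i<N. \<bar>f (p (Suc i)) - f (p i)\<bar>) + e" if "e > 0" for e
    proof -
      have "V b - e < Sup (S b)" using that V_def by simp
      then obtain s where "s \<in> S b" "V b - e < s" using less_cSupD[OF ne[OF ab]] by blast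
      moreover have "V a \<ge> 0" unfolding V_def by (rule cSup_upper[OF S0 bdd[OF ab]])
      ultimately show ?thesis unfolding S_def by fastforce
    qed
  qed
qed

text \<open>Clamping \<open>x\<close> to the cell from \<open>p j\<close> to
  \<open>p (Suc j)\<close> leaves the increment of \<open>g\<close> over the part of that cell to
  the left of \<open>x\<close>, so the sum telescopes up to \<open>x\<close>.\<close>

lemma sum_clamp_increments:
  fixes p :: "nat \<Rightarrow> real" and g :: "real \<Rightarrow> real"
  assumes "mono p" "p 0 \<le> x"
  shows "(\<Sum>j<N. g (max (p j) (min x (p (Suc j)))) - g (p j)) = g (min x (p N)) - g (p 0)"
proof (induction N)
  case 0
  then show ?case using assms by (simp add: min_absorb2)
next
  case (Suc N)
  have "p N \<le> p (Suc N)" using assms by (simp add: mono_def)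
  then show ?case using Suc by (auto simp: max_def min_def)
qed

text \<open>The function \<open>h\<close> is \<open>f\<close> with its graph reflected on those partition intervals over which
  \<open>f\<close> decreases, so that \<open>h\<close> increases by the full partition sum of \<open>f\<close>. If the partition is nearly
  optimal for the variation \<open>V\<close>, the monotone function \<open>V - h\<close> has small total increment.\<close>

lemma folding:
  fixes f :: "real \<Rightarrow> real"
  assumes V: "\<And>x y. a \<le> x \<Longrightarrow> x \<le> y \<Longrightarrow> y \<le> b \<Longrightarrow> \<bar>f y - f x\<bar> \<le> V y - V x"
    and p: "mono p" "p 0 = a" "p N = b"
  obtains h where "mono_on {a..b} (\<lambda>x. V x - h x)"
    and "h b - h a = (\<Sum>i<N. \<bar>f (p (Suc i)) - f (p i)\<bar>)"
    and "\<And>x. a < x \<Longrightarrow> x < b \<Longrightarrow> x \<notin> p ` {..N} \<Longrightarrow>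
       \<exists>r>0. \<exists>s\<in>{1, -1}. \<forall>u v. x - r \<le> u \<longrightarrow> u \<le> x \<longrightarrow> x \<le> v \<longrightarrow> v \<le> x + r \<longrightarrow>
              h v - h u = s * (f v - f u)"
proof -
  define s where "s j = (if f (p j) \<le> f (p (Suc j)) then 1 else -1 :: real)" for j
  define cl where "cl j x = max (p j) (min x (p (Suc j)))" for j x
  \<comment> \<open>The summand for \<open>j\<close> varies only while \<open>x\<close> crosses the
    cell \<open>j\<close>, and its sign \<open>s j\<close> makes the crossing contribute the
    absolute increment of \<open>f\<close>.\<close>
  define h where "h x = (\<Sum>j<N. s j * f (cl j x))" for x
  have pm: "p i \<le> p j" if "i \<le> j" for i j using p(1) that by (simp add: mono_def)
  have s1: "s j \<in> {1, -1}" for j by (auto simp: s_def)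
  have hd: "h y - h x = (\<Sum>j<N. s j * (f (cl j y) - f (cl j x)))" for x y
    by (simp add: h_def sum_subtractf right_diff_distrib)
  show ?thesis
  proof
    show "mono_on {a..b} (\<lambda>x. V x - h x)"
    proof (rule mono_onI)
      fix x y assume xy: "x \<in> {a..b}" "y \<in> {a..b}" "x \<le> y"
      \<comment> \<open>The bound by \<open>V\<close> is applied in each cell separately; the
        increments of \<open>V\<close> then telescope back to \<open>V y - V x\<close>.\<close>
      have "h y - h x \<le> (\<Sum>j<N. V (cl j y) - V (cl j x))"
        unfolding hd
      proof (rule sum_mono)
        fix j assume j: "j \<in> {..<N}"
        have "a \<le> p j" "p j \<le> p (Suc j)" "p (Suc j) \<le> b" using pm[of 0 j] pm[of j "Suc j"] pm[of "Suc j" N] p j by auto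
        then have "\<bar>f (cl j y) - f (cl j x)\<bar> \<le> V (cl j y) - V (cl j x)"
          using xy by (intro V) (auto simp: cl_def)
        then show "s j * (f (cl j y) - f (cl j x)) \<le> V (cl j y) - V (cl j x)"
          using s1[of j] by auto
      qed
      also have "\<dots> = (\<Sum>j<N. V (cl j y) - V (p j)) - (\<Sum>j<N. V (cl j x) - V (p j))"
        by (simp add: sum_subtractf)
      also have "\<dots> = V y - V x"
        unfolding cl_def using xy p by (subst (1 2) sum_clamp_increments) auto
      finally show "V x - h x \<le> V y - h y" by simp
    qed
    have "cl j b = p (Suc j)" "cl j a = p j" if "j < N" for j
      using pm[of 0 j] pm[of j "Suc j"] pm[of "Suc j" N] p that unfolding cl_def by auto
    then show "h b - h a = (\<Sum>i<N. \<bar>f (p (Suc i)) - f (p i)\<bar>)"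
      unfolding hd by (intro sum.cong) (auto simp: s_def)
    fix x assume x: "a < x" "x < b" "x \<notin> p ` {..N}"
    \<comment> \<open>This is the cell that contains \<open>x\<close>. Since \<open>x\<close> is not
      a partition point, it lies in the interior, so near \<open>x\<close> only the summand
      \<open>i\<close> moves.\<close>
    define i where "i = (LEAST i. x \<le> p (Suc i))"
    have "N \<noteq> 0" using x p by (cases N) auto
    then have ex: "x \<le> p (Suc (N - 1))" using x p by simp
    have "x \<le> p (Suc i)" unfolding i_def using ex by (rule LeastI)
    have "i \<le> N - 1" unfolding i_def using ex by (rule Least_le)
    then have "i < N" using \<open>N \<noteq> 0\<close> by simp
    have "p i \<le> x"
    proof (cases i)
      case (Suc k)
      then have "\<not> x \<le> p (Suc k)" using not_less_Least[of k "\<lambda>i. x \<le> p (Suc i)"] by (simp add: i_def)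
      then show ?thesis using Suc by simp
    qed (use x p in simp)
    then have xi: "p i < x" "x < p (Suc i)"
      using x(3) \<open>x \<le> p (Suc i)\<close> \<open>i < N\<close> by (auto simp: less_le)
    have "h v - h u = s i * (f v - f u)" if uv: "p i \<le> u" "u \<le> v" "v \<le> p (Suc i)" for u v
    proof -
      have "cl j v = cl j u" if "j \<noteq> i" for j
      proof (cases "j < i")
        case True
        then have "p (Suc j) \<le> p i" "p j \<le> p i" by (auto intro: pm)
        then show ?thesis using uv unfolding cl_def by auto
      next
        case False
        then have "p (Suc i) \<le> p j" "p (Suc i) \<le> p (Suc j)" using that by (auto intro: pm)
        then show ?thesis using uv unfolding cl_def by auto
      qed
      then have "h v - h u = (\<Sum>j<N. if j = i then s i * (f (cl i v) - f (cl i u)) else 0)"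
        unfolding hd by (intro sum.cong) auto
      also have "\<dots> = s i * (f (cl i v) - f (cl i u))" using \<open>i < N\<close> by simp
      also have "cl i v = v" using uv unfolding cl_def by auto
      also have "cl i u = u" using uv unfolding cl_def by auto
      finally show ?thesis .
    qed
    then show "\<exists>r>0. \<exists>s\<in>{1, -1}. \<forall>u v. x - r \<le> u \<longrightarrow> u \<le> x \<longrightarrow> x \<le> v \<longrightarrow> v \<le> x + r \<longrightarrow>
              h v - h u = s * (f v - f u)"
      using xi s1[of i] by (intro exI[of _ "min (x - p i) (p (Suc i) - x)"] conjI bexI[of _ "s i"]) auto
  qed
qed

text \<open>On its interval \<open>h\<close> is \<open>f\<close> or \<open>- f\<close> up to a constant, so a point where both \<open>f\<close> and
  \<open>- f\<close> are steep is a point where \<open>- h\<close>, and hence \<open>V - h\<close>, is steep.\<close>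

lemma oscillation_set_negligible:
  assumes f: "variation_bounded a b f" and c: "c > 0"
  shows "negligible {x. a < x \<and> x < b \<and> steep_at c f x \<and> steep_at c (\<lambda>x. - f x) x}"
    (is "negligible ?E")
proof (cases "a \<le> b")
  case False
  then have "?E = {}" by auto
  then show ?thesis by (simp only: negligible_empty)
next
  case True
  from variation_function[OF f True] obtain V where
    V: "\<And>x y. a \<le> x \<Longrightarrow> x \<le> y \<Longrightarrow> y \<le> b \<Longrightarrow> \<bar>f y - f x\<bar> \<le> V y - V x"
    and pe: "\<And>e. e > 0 \<Longrightarrow> \<exists>p N. mono p \<and> p 0 = a \<and> p N = b \<and>
            V b - V a \<le> (\<Sum>i<N. \<bar>f (p (Suc i)) - f (p i)\<bar>) + e" by blast
  show ?thesis
    unfolding negligible_outer_le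
  proof (intro allI impI)
    fix e :: real assume "e > 0"
    \<comment> \<open>The covering estimate divides by \<open>c\<close>, so a defect of
      \<open>e * c\<close> in the partition sum yields measure at most \<open>e\<close>.\<close>
    then have "e * c > 0" using c by simp
    from pe[OF this] obtain p N where p: "mono p" "p 0 = a" "p N = b"
      and pV: "V b - V a \<le> (\<Sum>i<N. \<bar>f (p (Suc i)) - f (p i)\<bar>) + e * c" by blast
    obtain h where mono: "mono_on {a..b} (\<lambda>x. V x - h x)"
      and hba: "h b - h a = (\<Sum>i<N. \<bar>f (p (Suc i)) - f (p i)\<bar>)"
      and loc: "\<And>x. a < x \<Longrightarrow> x < b \<Longrightarrow> x \<notin> p ` {..N} \<Longrightarrow>
       \<exists>r>0. \<exists>s\<in>{1, -1}. \<forall>u v. x - r \<le> u \<longrightarrow> u \<le> x \<longrightarrow> x \<le> v \<longrightarrow> v \<le> x + r \<longrightarrow>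
              h v - h u = s * (f v - f u)"
      using folding[of a b f V p N, OF V p] by blast
    \<comment> \<open>The sign may switch at the partition points; they are finitely many and are
      added back to the cover as a null set.\<close>
    let ?P = "p ` {..N}"
    have "steep_at c (\<lambda>x. V x - h x) x" if x: "x \<in> ?E - ?P" for x
    proof -
      have ax: "a < x" "x < b" using x by auto
      obtain r s where r: "r > 0" and s: "s = 1 \<or> s = (-1::real)"
        and hs: "\<And>u v. x - r \<le> u \<Longrightarrow> u \<le> x \<Longrightarrow> x \<le> v \<Longrightarrow> v \<le> x + r \<Longrightarrow> h v - h u = s * (f v - f u)"
        using loc[of x] x by blast
      have st: "steep_at c (\<lambda>x. - s * f x) x" using x s by auto
      show ?thesis
      proof (rule steep_at_local[OF st, of "min r (min (x - a) (b - x))"])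
        show "0 < min r (min (x - a) (b - x))" using r ax by simp
        fix u v assume uv: "x - min r (min (x - a) (b - x)) \<le> u" "u \<le> x" "x \<le> v"
          "v \<le> x + min r (min (x - a) (b - x))" "c * (v - u) \<le> - s * f v - - s * f u"
        have "h v - h u = s * (f v - f u)" using uv by (intro hs) auto
        moreover have "\<bar>f v - f u\<bar> \<le> V v - V u" using uv by (intro V) auto
        ultimately show "c * (v - u) \<le> V v - h v - (V u - h u)"
          using uv(5) by (auto simp: algebra_simps)
      qed
    qed
    then obtain T where T: "?E - ?P \<subseteq> T" "T \<in> lmeasurable"
      "measure lebesgue T \<le> (V b - h b - (V a - h a)) / c"
      using steep_set_outer_measure[OF mono True c, of "?E - ?P"] by blast
    have P: "negligible ?P" by (intro negligible_finite) simp
    have "measure lebesgue (T \<union> ?P) \<le> measure lebesgue T + measure lebesgue ?P"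
      by (rule measure_Un_le[OF fmeasurableD[OF T(2)] negligible_imp_sets[OF P]])
    also have "\<dots> \<le> (V b - h b - (V a - h a)) / c" using T negligible_imp_measure0[OF P] by simp
    also have "\<dots> \<le> e" using pV hba c by (simp add: field_simps)
    finally have "measure lebesgue (T \<union> ?P) \<le> e" .
    moreover have "T \<union> ?P \<in> lmeasurable" by (rule fmeasurable.Un[OF T(2) negligible_imp_measurable[OF P]])
    ultimately show "\<exists>T. ?E \<subseteq> T \<and> T \<in> lmeasurable \<and> measure lebesgue T \<le> e"
      using T(1) by (intro exI[of _ "T \<union> ?P"]) blast
  qed
qed

section \<open>Derivates of a function of bounded variation\<close>

lemma variation_bounded_diff_linear:
  assumes "variation_bounded a b f"
  shows "variation_bounded a b (\<lambda>x. f x - m * x)"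
proof -
  from assms obtain B where
    B: "\<And>p N. mono p \<Longrightarrow> p 0 = a \<Longrightarrow> p N = b \<Longrightarrow> (\<Sum>i<N. \<bar>f (p (Suc i)) - f (p i)\<bar>) \<le> B"
    unfolding variation_bounded_def by blast
  have "(\<Sum>i<N. \<bar>(f (p (Suc i)) - m * p (Suc i)) - (f (p i) - m * p i)\<bar>) \<le> B + \<bar>m\<bar> * (b - a)"
    if p: "mono p" "p 0 = a" "p N = b" for p N
  proof -
    have "(\<Sum>i<N. \<bar>(f (p (Suc i)) - m * p (Suc i)) - (f (p i) - m * p i)\<bar>)
      \<le> (\<Sum>i<N. \<bar>f (p (Suc i)) - f (p i)\<bar> + \<bar>m\<bar> * (p (Suc i) - p i))"
    proof (rule sum_mono)
      fix i
      have "p i \<le> p (Suc i)" using p(1) by (simp add: mono_def)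
      then have "\<bar>m * (p (Suc i) - p i)\<bar> = \<bar>m\<bar> * (p (Suc i) - p i)" by (simp add: abs_mult)
      moreover have "(f (p (Suc i)) - m * p (Suc i)) - (f (p i) - m * p i)
          = (f (p (Suc i)) - f (p i)) - m * (p (Suc i) - p i)" by (simp add: algebra_simps)
      ultimately show "\<bar>(f (p (Suc i)) - m * p (Suc i)) - (f (p i) - m * p i)\<bar>
          \<le> \<bar>f (p (Suc i)) - f (p i)\<bar> + \<bar>m\<bar> * (p (Suc i) - p i)" by linarith
    qed
    also have "\<dots> = (\<Sum>i<N. \<bar>f (p (Suc i)) - f (p i)\<bar>) + \<bar>m\<bar> * (b - a)"
      using p by (simp add: sum.distrib sum_lessThan_telescope flip: sum_distrib_left)
    finally show ?thesis using B[OF p] by linarith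
  qed
  then show ?thesis unfolding variation_bounded_def by blast
qed

text \<open>Subtracting the line of mean slope \<open>(r + R) / 2\<close> makes the gap symmetric:
  both the corrected function and its negative are steep with constant
  \<open>(R - r) / 2\<close>.\<close>

lemma derivate_gap_set_negligible:
  assumes f: "variation_bounded a b f" and "r < R"
  shows "negligible {x. a < x \<and> x < b \<and> steep_at R f x \<and> steep_at (- r) (\<lambda>x. - f x) x}"
proof -
  let ?m = "(r + R) / 2" and ?c = "(R - r) / 2"
  let ?g = "\<lambda>x. f x - ?m * x"
  have "steep_at ?c ?g x" if "steep_at R f x" for x
    using that zero_less_one by (rule steep_at_local) (simp add: field_simps)
  moreover have "steep_at ?c (\<lambda>x. - ?g x) x" if "steep_at (- r) (\<lambda>x. - f x) x" for x
    using that zero_less_one by (rule steep_at_local) (simp add: field_simps)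
  ultimately have "{x. a < x \<and> x < b \<and> steep_at R f x \<and> steep_at (- r) (\<lambda>x. - f x) x}
    \<subseteq> {x. a < x \<and> x < b \<and> steep_at ?c ?g x \<and> steep_at ?c (\<lambda>x. - ?g x) x}"
    by blast
  moreover have "negligible {x. a < x \<and> x < b \<and> steep_at ?c ?g x \<and> steep_at ?c (\<lambda>x. - ?g x) x}"
    using \<open>r < R\<close> by (intro oscillation_set_negligible variation_bounded_diff_linear f) simp
  ultimately show ?thesis by (rule negligible_subset[rotated])
qed

text \<open>Increments of \<open>f\<close> and \<open>- f\<close> are dominated by those of the
  monotone \<open>V\<close>, so the set lies in the steep set of \<open>V\<close> for every
  \<open>c\<close>, whose outer measure is at most \<open>(V b - V a) / c\<close>.\<close>

lemma infinite_derivate_set_negligible: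
  assumes f: "variation_bounded a b f"
  shows "negligible {x. a < x \<and> x < b \<and>
           (\<forall>c>0. steep_at c f x \<or> steep_at c (\<lambda>x. - f x) x)}" (is "negligible ?E")
proof (cases "a \<le> b")
  case False
  then have "?E = {}" by auto
  then show ?thesis by (simp only: negligible_empty)
next
  case True
  obtain V where V: "\<And>x y. a \<le> x \<Longrightarrow> x \<le> y \<Longrightarrow> y \<le> b \<Longrightarrow> \<bar>f y - f x\<bar> \<le> V y - V x"
    using variation_function[OF f True] by metis
  have mono: "mono_on {a..b} V"
  proof (rule mono_onI)
    fix x y assume "x \<in> {a..b}" "y \<in> {a..b}" "x \<le> y"
    then have "\<bar>f y - f x\<bar> \<le> V y - V x" by (intro V) auto
    then show "V x \<le> V y" by linarith
  qed
  show ?thesis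
    unfolding negligible_outer_le
  proof (intro allI impI)
    fix e :: real assume "e > 0"
    have "V a \<le> V b" using mono True by (auto simp: mono_on_def)
    \<comment> \<open>The summand 1 keeps \<open>c\<close> positive even if
      \<open>V b = V a\<close>.\<close>
    define c where "c = (V b - V a) / e + 1"
    have "c > 0" using \<open>V a \<le> V b\<close> \<open>e > 0\<close> by (simp add: c_def add_nonneg_pos)
    have "a < x \<and> x < b \<and> steep_at c V x" if x: "x \<in> ?E" for x
    proof -
      have ax: "a < x" "x < b" using x by auto
      have st: "steep_at c V x" if "steep_at c g x" "\<And>u v. g v - g u \<le> \<bar>f v - f u\<bar>" for g
      proof (rule steep_at_local[OF that(1)])
        show "0 < min (x - a) (b - x)" using ax by simp
        fix u v
        assume uv: "x - min (x - a) (b - x) \<le> u" "u \<le> x" "x \<le> v" "v \<le> x + min (x - a) (b - x)"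
          "c * (v - u) \<le> g v - g u"
        have "\<bar>f v - f u\<bar> \<le> V v - V u" using uv(1-4) by (intro V) auto
        then show "c * (v - u) \<le> V v - V u" using uv(5) that(2)[of v u] by linarith
      qed
      from x \<open>c > 0\<close> have "steep_at c f x \<or> steep_at c (\<lambda>x. - f x) x" by blast
      then have "steep_at c V x" using st[of f] st[of "\<lambda>x. - f x"] by auto
      then show ?thesis using ax by blast
    qed
    then obtain T where T: "?E \<subseteq> T" "T \<in> lmeasurable" "measure lebesgue T \<le> (V b - V a) / c"
      by (rule steep_set_outer_measure[OF mono True \<open>c > 0\<close>])
    have "(V b - V a) / c \<le> e"
      using \<open>c > 0\<close> \<open>e > 0\<close> by (simp add: c_def field_simps)
    then show "\<exists>T. ?E \<subseteq> T \<and> T \<in> lmeasurable \<and> measure lebesgue T \<le> e"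
      using T by (intro exI[of _ T] conjI) auto
  qed
qed

text \<open>The intervals in \<open>steep_at\<close> may have \<open>x\<close> as an endpoint, so
  the failure of steepness bounds the difference quotients on both sides of
  \<open>x\<close>.\<close>

lemma not_steep_slope:
  assumes "\<not> steep_at c f x"
  shows "\<forall>\<^sub>F y in at x. (f y - f x) / (y - x) < c"
proof -
  from assms obtain d where d: "d > 0"
    "\<And>u v. u \<le> x \<Longrightarrow> x \<le> v \<Longrightarrow> u < v \<Longrightarrow> v - u < d \<Longrightarrow> f v - f u < c * (v - u)"
    unfolding steep_at_def not_all not_imp not_ex de_Morgan_conj not_le by (metis not_le)
  show ?thesis
    unfolding eventually_at
  proof (intro exI conjI ballI impI)
    fix y assume "y \<noteq> x \<and> dist y x < d"
    then consider "x < y" "y - x < d" | "y < x" "x - y < d" by (auto simp: dist_real_def abs_if split: if_splits)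
    then show "(f y - f x) / (y - x) < c"
    proof cases
      case 1
      then show ?thesis using d(2)[of x y] by (simp add: pos_divide_less_eq)
    next
      case 2
      then show ?thesis using d(2)[of y x] by (simp add: neg_divide_less_eq algebra_simps)
    qed
  qed (use d in simp)
qed

lemma differentiable_if_not_steep:
  fixes f :: "real \<Rightarrow> real"
  assumes bd: "c > 0" "\<not> steep_at c f x" "\<not> steep_at c (\<lambda>x. - f x) x"
    and gap: "\<And>r R. r \<in> \<rat> \<Longrightarrow> R \<in> \<rat> \<Longrightarrow> r < R \<Longrightarrow> \<not> (steep_at R f x \<and> steep_at (- r) (\<lambda>x. - f x) x)"
  shows "f differentiable (at x)"
proof -
  define q where "q y = (f y - f x) / (y - x)" for y
  have up: "\<forall>\<^sub>F y in at x. q y < t" if "\<not> steep_at t f x" for t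
    using not_steep_slope[OF that] by (simp add: q_def)
  have lo: "\<forall>\<^sub>F y in at x. t < q y" if "\<not> steep_at (- t) (\<lambda>x. - f x) x" for t
  proof -
    have "- q y = (- f y - - f x) / (y - x)" for y
      unfolding q_def minus_divide_left by simp
    then have "\<forall>\<^sub>F y in at x. - q y < - t" using not_steep_slope[OF that] by simp
    then show ?thesis by simp
  qed
  \<comment> \<open>The supremum of \<open>A\<close> is the lower limit of the difference quotients
    at \<open>x\<close>, the candidate for the derivative.\<close>
  define A where "A = {t. \<forall>\<^sub>F y in at x. t \<le> q y}"
  have "- c \<in> A"
    using lo[of "- c"] bd(3) unfolding A_def by (auto elim: eventually_mono)
  have bdd: "bdd_above A"
  proof (rule bdd_aboveI)
    fix t assume "t \<in> A"
    then have "\<forall>\<^sub>F y in at x. t \<le> q y \<and> q y < c"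
      unfolding A_def using up[OF bd(2)] by (simp add: eventually_conj)
    then show "t \<le> c" using eventually_happens[of _ "at x"] by fastforce
  qed
  have "(q \<longlongrightarrow> Sup A) (at x)"
  proof (rule order_tendstoI)
    fix l assume "l < Sup A"
    then obtain t where "t \<in> A" "l < t" using \<open>- c \<in> A\<close> less_cSupD[of A l] by blast
    then show "\<forall>\<^sub>F y in at x. l < q y" unfolding A_def by (auto elim: eventually_mono)
  next
    fix l assume l: "Sup A < l"
    \<comment> \<open>Quotients fail to stay above \<open>r\<close> near \<open>x\<close>, so
      \<open>- f\<close> is steep with constant \<open>- r\<close>. The gap hypothesis then denies
      steepness of \<open>f\<close> at the second rational \<open>R\<close>, which keeps the nearby
      quotients below \<open>R < l\<close>.\<close>
    obtain r where r: "r \<in> \<rat>" "Sup A < r" "r < l" using Rats_dense_in_real[OF l] by blast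
    obtain R where R: "R \<in> \<rat>" "r < R" "R < l" using Rats_dense_in_real[OF r(3)] by blast
    have "r \<notin> A" using cSup_upper[OF _ bdd, of r] r by auto
    then have "\<not> (\<forall>\<^sub>F y in at x. r < q y)"
      unfolding A_def by (metis (mono_tags, lifting) eventually_mono less_imp_le mem_Collect_eq)
    then have "steep_at (- r) (\<lambda>x. - f x) x" using lo[of r] by blast
    with gap[OF r(1) R(1,2)] have "\<not> steep_at R f x" by blast
    then show "\<forall>\<^sub>F y in at x. q y < l" using up[of R] R(3) by (auto elim!: eventually_mono)
  qed
  then have "(f has_field_derivative Sup A) (at x)"
    unfolding has_field_derivative_iff q_def by simp
  then show ?thesis using field_differentiable_imp_differentiable field_differentiable_def by blast
qed

text \<open>A point of non-differentiability has either an infinite derivate or two distinct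
  derivates separated by rationals; the latter case is a countable union of null sets.\<close>

lemma variation_bounded_differentiable_ae:
  assumes f: "variation_bounded a b f"
  shows "negligible {x. a < x \<and> x < b \<and> \<not> f differentiable (at x)}"
proof -
  let ?D = "\<lambda>(r, R). {x. a < x \<and> x < b \<and> steep_at R f x \<and> steep_at (- r) (\<lambda>x. - f x) x}"
  let ?I = "{(r::real, R::real). r \<in> \<rat> \<and> R \<in> \<rat> \<and> r < R}"
  let ?E = "{x. a < x \<and> x < b \<and> (\<forall>c>0. steep_at c f x \<or> steep_at c (\<lambda>x. - f x) x)}"
  have "countable (\<rat> \<times> \<rat> :: (real \<times> real) set)" by (simp add: countable_rat)
  then have "countable ?I" by (rule countable_subset[rotated]) blast
  then have "negligible (\<Union> (?D ` ?I))"
    using derivate_gap_set_negligible[OF f] by (intro negligible_countable_Union) fastforce+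
  then have "negligible (?E \<union> \<Union> (?D ` ?I))"
    using infinite_derivate_set_negligible[OF f] by (rule negligible_Un[rotated])
  moreover have "{x. a < x \<and> x < b \<and> \<not> f differentiable (at x)} \<subseteq> ?E \<union> \<Union> (?D ` ?I)"
  proof
    fix x assume x: "x \<in> {x. a < x \<and> x < b \<and> \<not> f differentiable (at x)}"
    show "x \<in> ?E \<union> \<Union> (?D ` ?I)"
    proof (rule ccontr)
      assume n: "x \<notin> ?E \<union> \<Union> (?D ` ?I)"
      then obtain c where "c > 0" "\<not> steep_at c f x" "\<not> steep_at c (\<lambda>x. - f x) x" using x by blast
      then have "f differentiable (at x)"
        by (rule differentiable_if_not_steep) (use n x in auto)
      then show False using x by simp
    qed
  qed
  ultimately show ?thesis by (rule negligible_subset)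
qed

section \<open>Absolutely continuous functions\<close>

text \<open>Absolute continuity with tolerance 1 provides \<open>d\<close>. Consecutive cells of a
  partition of an interval shorter than \<open>d\<close> form an admissible family, so every
  partition sum is below 1.\<close>

lemma abs_cont_on_variation_bounded:
  assumes "abs_cont_on {a..b} f"
  obtains d where "d > 0"
    "\<And>u v. a \<le> u \<Longrightarrow> v \<le> b \<Longrightarrow> v - u < d \<Longrightarrow> variation_bounded u v f"
proof -
  obtain d where d: "d > 0" and
    ac: "\<forall>(N::nat) s t. (\<forall>i<N. s i \<le> t i \<and> {s i..t i} \<subseteq> {a..b}) \<and>
        (\<forall>i<N. \<forall>j<N. i \<noteq> j \<longrightarrow> t i \<le> s j \<or> t j \<le> s i) \<and>
        (\<Sum>i<N. t i - s i) < d \<longrightarrow> (\<Sum>i<N. \<bar>f (t i) - f (s i)\<bar>) < 1"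
    using assms[unfolded abs_cont_on_def, rule_format, OF zero_less_one] by blast
  show ?thesis
  proof
    fix u v assume uv: "a \<le> u" "v \<le> b" "v - u < d"
    have "(\<Sum>i<N. \<bar>f (p (Suc i)) - f (p i)\<bar>) \<le> 1"
      if p: "mono p" "p 0 = u" "p N = v" for p N
    proof -
      have pm: "p i \<le> p j" if "i \<le> j" for i j using p(1) that by (simp add: mono_def)
      have "(\<Sum>i<N. \<bar>f (p (Suc i)) - f (p i)\<bar>) < 1"
      proof (rule ac[THEN spec, of N, THEN spec, of p, THEN spec, of "\<lambda>i. p (Suc i)", THEN mp], intro conjI)
        show "\<forall>i<N. p i \<le> p (Suc i) \<and> {p i..p (Suc i)} \<subseteq> {a..b}"
        proof (intro allI impI conjI)
          fix i assume "i < N"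
          then show "{p i..p (Suc i)} \<subseteq> {a..b}"
            using pm[of 0 i] pm[of "Suc i" N] p uv by auto
        qed (auto intro: pm)
        show "\<forall>i<N. \<forall>j<N. i \<noteq> j \<longrightarrow> p (Suc i) \<le> p j \<or> p (Suc j) \<le> p i"
          by (metis Suc_leI linorder_neqE_nat pm)
        show "(\<Sum>i<N. p (Suc i) - p i) < d"
          using p uv by (simp add: sum_lessThan_telescope)
      qed
      then show ?thesis by simp
    qed
    then show "variation_bounded u v f" unfolding variation_bounded_def by blast
  qed (rule d)
qed

text \<open>Bounded variation is available only on short intervals, and negligibility is a local
  property, so a short neighbourhood of each point suffices.\<close>

lemma abs_cont_on_differentiable_ae:
  assumes "abs_cont_on {a..b} f"
  shows "negligible {x. a < x \<and> x < b \<and> \<not> f differentiable (at x)}" (is "negligible ?S")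
  unfolding locally_negligible_alt[of ?S]
proof
  fix x assume x: "x \<in> ?S"
  obtain d where d: "d > 0"
    and bv: "\<And>u v. a \<le> u \<Longrightarrow> v \<le> b \<Longrightarrow> v - u < d \<Longrightarrow> variation_bounded u v f"
    using abs_cont_on_variation_bounded[OF assms] by blast
  let ?u = "max a (x - d / 3)" and ?v = "min b (x + d / 3)"
  have "variation_bounded ?u ?v f" using d by (intro bv) auto
  then have "negligible {y. ?u < y \<and> y < ?v \<and> \<not> f differentiable (at y)}"
    by (rule variation_bounded_differentiable_ae)
  then have "negligible (?S \<inter> {?u<..<?v})" by (rule negligible_subset) auto
  moreover have "openin (top_of_set ?S) (?S \<inter> {?u<..<?v})"
    by (intro openin_open_Int) simp
  moreover have "x \<in> ?S \<inter> {?u<..<?v}" using x d by auto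
  ultimately show "\<exists>U. openin (top_of_set ?S) U \<and> x \<in> U \<and> negligible U" by blast
qed

section \<open>Linearity and uniqueness\<close>

text \<open>Derivatives within a nondegenerate interval are unique, so a computed derivative
  determines the next \<open>hderiv\<close>. The formula \<open>g\<close> has to hold on the whole
  interval, because the derivative depends on nearby values.\<close>

lemma hderiv_SucI:
  assumes "a < b" "t \<in> {a..b}" "\<And>s. s \<in> {a..b} \<Longrightarrow> hderiv {a..b} k u s = g s"
    and "(g has_vector_derivative D) (at t within {a..b})"
  shows "(hderiv {a..b} k u has_vector_derivative D) (at t within {a..b})"
    and "hderiv {a..b} (Suc k) u t = D"
proof -
  show d: "(hderiv {a..b} k u has_vector_derivative D) (at t within {a..b})"
    by (rule has_vector_derivative_transform[OF assms(2) assms(3) assms(4)])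
  show "hderiv {a..b} (Suc k) u t = D"
    using vector_derivative_within_closed_interval[OF assms(1,2) d] by simp
qed

lemma WspD:
  assumes "Wsp m K u"
  shows "Suc k < m \<Longrightarrow> t \<in> K \<Longrightarrow>
      (hderiv K k u has_vector_derivative hderiv K (Suc k) u t) (at t within K)"
    and "k < m \<Longrightarrow> continuous_on K (hderiv K k u)"
    and "abs_cont_on K (hderiv K (m - 1) u)"
  using assms unfolding Wsp_def by simp_all

lemma abs_cont_on_cong:
  assumes "abs_cont_on K f" "\<And>t. t \<in> K \<Longrightarrow> g t = f t"
  shows "abs_cont_on K g"
  unfolding abs_cont_on_def
proof (intro allI impI)
  fix e :: real assume "e > 0"
  obtain d where d: "d > 0" and
    ac: "\<forall>(N::nat) s t. (\<forall>i<N. s i \<le> t i \<and> {s i..t i} \<subseteq> K) \<and>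
        (\<forall>i<N. \<forall>j<N. i \<noteq> j \<longrightarrow> t i \<le> s j \<or> t j \<le> s i) \<and>
        (\<Sum>i<N. t i - s i) < d \<longrightarrow> (\<Sum>i<N. \<bar>f (t i) - f (s i)\<bar>) < e"
    using assms(1)[unfolded abs_cont_on_def, rule_format, OF \<open>e > 0\<close>] by blast
  show "\<exists>d>0. \<forall>(N::nat) s t. (\<forall>i<N. s i \<le> t i \<and> {s i..t i} \<subseteq> K) \<and>
        (\<forall>i<N. \<forall>j<N. i \<noteq> j \<longrightarrow> t i \<le> s j \<or> t j \<le> s i) \<and>
        (\<Sum>i<N. t i - s i) < d \<longrightarrow> (\<Sum>i<N. \<bar>g (t i) - g (s i)\<bar>) < e"
  proof (intro exI[of _ d] conjI allI impI d)
    fix N :: nat and s t :: "nat \<Rightarrow> real"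
    assume st: "(\<forall>i<N. s i \<le> t i \<and> {s i..t i} \<subseteq> K) \<and>
        (\<forall>i<N. \<forall>j<N. i \<noteq> j \<longrightarrow> t i \<le> s j \<or> t j \<le> s i) \<and> (\<Sum>i<N. t i - s i) < d"
    then have "(\<Sum>i<N. \<bar>f (t i) - f (s i)\<bar>) < e" using ac by blast
    moreover have "s i \<in> K" "t i \<in> K" if "i < N" for i
    proof -
      have "s i \<le> t i" "{s i..t i} \<subseteq> K" using st that by auto
      moreover from this(1) have "s i \<in> {s i..t i}" "t i \<in> {s i..t i}" by auto
      ultimately show "s i \<in> K" "t i \<in> K" by blast+
    qed
    ultimately show "(\<Sum>i<N. \<bar>g (t i) - g (s i)\<bar>) < e" using assms(2) by simp
  qed
qed

lemma abs_cont_on_diff: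
  assumes "abs_cont_on K f" "abs_cont_on K g"
  shows "abs_cont_on K (\<lambda>t. f t - g t)"
  unfolding abs_cont_on_def
proof (intro allI impI)
  fix e :: real assume "e > 0"
  then have "e / 2 > 0" by simp
  from assms(1)[unfolded abs_cont_on_def, rule_format, OF this]
  obtain d1 where d1: "d1 > 0" and
    ac1: "\<forall>(N::nat) s t. (\<forall>i<N. s i \<le> t i \<and> {s i..t i} \<subseteq> K) \<and>
        (\<forall>i<N. \<forall>j<N. i \<noteq> j \<longrightarrow> t i \<le> s j \<or> t j \<le> s i) \<and>
        (\<Sum>i<N. t i - s i) < d1 \<longrightarrow> (\<Sum>i<N. \<bar>f (t i) - f (s i)\<bar>) < e / 2"
    by blast
  from assms(2)[unfolded abs_cont_on_def, rule_format, OF \<open>e / 2 > 0\<close>]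
  obtain d2 where d2: "d2 > 0" and
    ac2: "\<forall>(N::nat) s t. (\<forall>i<N. s i \<le> t i \<and> {s i..t i} \<subseteq> K) \<and>
        (\<forall>i<N. \<forall>j<N. i \<noteq> j \<longrightarrow> t i \<le> s j \<or> t j \<le> s i) \<and>
        (\<Sum>i<N. t i - s i) < d2 \<longrightarrow> (\<Sum>i<N. \<bar>g (t i) - g (s i)\<bar>) < e / 2"
    by blast
  show "\<exists>d>0. \<forall>(N::nat) s t. (\<forall>i<N. s i \<le> t i \<and> {s i..t i} \<subseteq> K) \<and>
        (\<forall>i<N. \<forall>j<N. i \<noteq> j \<longrightarrow> t i \<le> s j \<or> t j \<le> s i) \<and>
        (\<Sum>i<N. t i - s i) < d \<longrightarrow> (\<Sum>i<N. \<bar>(f (t i) - g (t i)) - (f (s i) - g (s i))\<bar>) < e"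
  proof (intro exI[of _ "min d1 d2"] conjI allI impI)
    fix N :: nat and s t :: "nat \<Rightarrow> real"
    assume st: "(\<forall>i<N. s i \<le> t i \<and> {s i..t i} \<subseteq> K) \<and>
        (\<forall>i<N. \<forall>j<N. i \<noteq> j \<longrightarrow> t i \<le> s j \<or> t j \<le> s i) \<and> (\<Sum>i<N. t i - s i) < min d1 d2"
    then have "(\<Sum>i<N. t i - s i) < d1" "(\<Sum>i<N. t i - s i) < d2" by auto
    with st ac1 ac2 have "(\<Sum>i<N. \<bar>f (t i) - f (s i)\<bar>) < e / 2" "(\<Sum>i<N. \<bar>g (t i) - g (s i)\<bar>) < e / 2"
      by blast+
    moreover have "(\<Sum>i<N. \<bar>(f (t i) - g (t i)) - (f (s i) - g (s i))\<bar>)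
        \<le> (\<Sum>i<N. \<bar>f (t i) - f (s i)\<bar> + \<bar>g (t i) - g (s i)\<bar>)"
      by (intro sum_mono) linarith
    ultimately show "(\<Sum>i<N. \<bar>(f (t i) - g (t i)) - (f (s i) - g (s i))\<bar>) < e"
      by (simp add: sum.distrib)
  qed (use d1 d2 in simp)
qed

text \<open>\<open>Wsp\<close> asserts no derivative of order \<open>m\<close>. Absolute continuity
  of order \<open>m - 1\<close> shows that \<open>hderiv\<close> of order \<open>m\<close> is a
  genuine derivative outside a null set.\<close>

lemma Wsp_top_derivative_ae:
  assumes "Wsp m {a..b} u" "m \<ge> 1"
  shows "AE t in lebesgue. t \<in> {a..b} \<longrightarrow>
    (hderiv {a..b} (m - 1) u has_vector_derivative hderiv {a..b} m u t) (at t within {a..b})"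
proof -
  let ?h = "hderiv {a..b} (m - 1) u"
  have m: "hderiv {a..b} m u = (\<lambda>t. vector_derivative ?h (at t within {a..b}))"
    using assms(2) by (cases m) auto
  have "negligible {x. a < x \<and> x < b \<and> \<not> ?h differentiable (at x)}"
    by (rule abs_cont_on_differentiable_ae[OF WspD(3)[OF assms(1)]])
  \<comment> \<open>The endpoints are added because the previous fact concerns interior points
    only.\<close>
  then have "{x. a < x \<and> x < b \<and> \<not> ?h differentiable (at x)} \<union> {a, b} \<in> null_sets lebesgue"
    by (simp add: negligible_iff_null_sets[symmetric] negligible_Un)
  then show ?thesis
  proof (rule AE_I')
    show "{t \<in> space lebesgue. \<not> (t \<in> {a..b} \<longrightarrow>
        (?h has_vector_derivative hderiv {a..b} m u t) (at t within {a..b}))}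
      \<subseteq> {x. a < x \<and> x < b \<and> \<not> ?h differentiable (at x)} \<union> {a, b}"
      unfolding m using differentiable_at_withinI vector_derivative_works by fastforce
  qed
qed

lemma hderiv_diff:
  assumes "a < b" "Wsp m {a..b} u" "Wsp m {a..b} v" "k < m" "t \<in> {a..b}"
  shows "hderiv {a..b} k (\<lambda>t. u t - v t) t = hderiv {a..b} k u t - hderiv {a..b} k v t"
  using assms(4,5)
proof (induction k arbitrary: t)
  case (Suc k)
  show ?case
  proof (rule hderiv_SucI(2)[OF assms(1) Suc.prems(2) Suc.IH])
    show "((\<lambda>s. hderiv {a..b} k u s - hderiv {a..b} k v s) has_vector_derivative
        hderiv {a..b} (Suc k) u t - hderiv {a..b} (Suc k) v t) (at t within {a..b})"
      by (intro has_vector_derivative_diff WspD(1)[OF assms(2)] WspD(1)[OF assms(3)] Suc.prems)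
  qed (use Suc.prems in auto)
qed simp

lemma Wsp_diff:
  assumes "a < b" "Wsp m {a..b} u" "Wsp m {a..b} v" "m \<ge> 1"
  shows "Wsp m {a..b} (\<lambda>t. u t - v t)"
proof -
  note hd = hderiv_diff[OF assms(1-3)]
  show ?thesis
    unfolding Wsp_def
  proof (intro conjI allI impI ballI)
    fix k t assume k: "Suc k < m" and t: "t \<in> {a..b}"
    have "((\<lambda>s. hderiv {a..b} k u s - hderiv {a..b} k v s) has_vector_derivative
        hderiv {a..b} (Suc k) u t - hderiv {a..b} (Suc k) v t) (at t within {a..b})"
      by (intro has_vector_derivative_diff WspD(1)[OF assms(2)] WspD(1)[OF assms(3)] k t)
    from hderiv_SucI(1)[OF assms(1) t hd this] k hd[OF k t]
    show "(hderiv {a..b} k (\<lambda>t. u t - v t) has_vector_derivative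
            hderiv {a..b} (Suc k) (\<lambda>t. u t - v t) t) (at t within {a..b})"
      by simp
  next
    fix k assume k: "k < m"
    have "continuous_on {a..b} (\<lambda>t. hderiv {a..b} k u t - hderiv {a..b} k v t)"
      by (intro continuous_on_diff WspD(2)[OF assms(2)] WspD(2)[OF assms(3)] k)
    then show "continuous_on {a..b} (hderiv {a..b} k (\<lambda>t. u t - v t))"
      by (rule continuous_on_eq) (simp add: hd[OF k])
  next
    show "abs_cont_on {a..b} (hderiv {a..b} (m - 1) (\<lambda>t. u t - v t))"
      using \<open>m \<ge> 1\<close>
      by (intro abs_cont_on_cong[OF abs_cont_on_diff[OF WspD(3)[OF assms(2)] WspD(3)[OF assms(3)]]] hd) auto
  qed
qed

text \<open>Below order \<open>m\<close> linearity holds everywhere; at order \<open>m\<close> it is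
  used only where both top derivatives exist, which is almost everywhere.\<close>

lemma solves_ae_diff:
  assumes "a < b" "Wsp m {a..b} u" "Wsp m {a..b} v" "m \<ge> 1"
    and "solves_ae m c {a..b} \<sigma> u" "solves_ae m c {a..b} \<tau> v"
  shows "solves_ae m c {a..b} (\<lambda>t. \<sigma> t - \<tau> t) (\<lambda>t. u t - v t)"
  using assms(5,6) Wsp_top_derivative_ae[OF assms(2,4)] Wsp_top_derivative_ae[OF assms(3,4)]
  unfolding solves_ae_def
proof eventually_elim
  case (elim t)
  show ?case
  proof
    assume t: "t \<in> {a..b}"
    note hd = hderiv_diff[OF assms(1-3)]
    have "hderiv {a..b} (Suc (m - 1)) (\<lambda>t. u t - v t) t = hderiv {a..b} m u t - hderiv {a..b} m v t"
      using elim t \<open>m \<ge> 1\<close>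
      by (intro hderiv_SucI(2)[OF assms(1) t hd] has_vector_derivative_diff) auto
    then have "hderiv {a..b} m (\<lambda>t. u t - v t) t = hderiv {a..b} m u t - hderiv {a..b} m v t"
      using \<open>m \<ge> 1\<close> by simp
    moreover have "(\<Sum>k<m. c k t * hderiv {a..b} k (\<lambda>t. u t - v t) t)
        = (\<Sum>k<m. c k t * hderiv {a..b} k u t) - (\<Sum>k<m. c k t * hderiv {a..b} k v t)"
      using hd[OF _ t] by (simp add: right_diff_distrib sum_subtractf)
    ultimately show "Lop m c {a..b} (\<lambda>t. u t - v t) t = \<sigma> t - \<tau> t"
      using elim t by (simp add: Lop_def)
  qed
qed

lemma XN_diff:
  assumes "T > 0" "XN m T u" "XN m T v" "m \<ge> 1"
  shows "XN m T (\<lambda>t. u t - v t)"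
proof -
  have W: "Wsp m {0..T} u" "Wsp m {0..T} v" using assms unfolding XN_def by auto
  have "hderiv {0..T} (2 * k + 1) (\<lambda>t. u t - v t) s = 0" if "k < m div 2" "s = 0 \<or> s = T" for k s
  proof -
    have "2 * k + 1 < m" "s \<in> {0..T}" using that \<open>T > 0\<close> by auto
    from hderiv_diff[OF \<open>T > 0\<close> W this] show ?thesis
      using assms(2,3) that unfolding XN_def by auto
  qed
  with Wsp_diff[OF \<open>T > 0\<close> W \<open>m \<ge> 1\<close>] show ?thesis unfolding XN_def by blast
qed

text \<open>The Green integral solves the same problem as \<open>u\<close>, so their difference
  solves the homogeneous one and vanishes by nonresonance.\<close>

lemma green_function_XN_represents:
  assumes G: "green_function m a {0..T} (XN m T) G" and "T > 0" "m \<ge> 1"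
    and \<sigma>: "\<sigma> absolutely_integrable_on {0..T}"
    and u: "XN m T u" "solves_ae m a {0..T} \<sigma> u" and t: "t \<in> {0..T}"
  shows "u t = integral {0..T} (\<lambda>s. G t s * \<sigma> s)"
proof -
  let ?v = "\<lambda>t. integral {0..T} (\<lambda>s. G t s * \<sigma> s)"
  have v: "XN m T ?v" "solves_ae m a {0..T} \<sigma> ?v"
    using G \<sigma> unfolding green_function_def by blast+
  have W: "Wsp m {0..T} u" "Wsp m {0..T} ?v" using u(1) v(1) unfolding XN_def by blast+
  have "solves_ae m a {0..T} (\<lambda>_. 0) (\<lambda>t. u t - ?v t)"
    using solves_ae_diff[OF \<open>T > 0\<close> W \<open>m \<ge> 1\<close> u(2) v(2)] by simp
  moreover have "XN m T (\<lambda>t. u t - ?v t)" by (rule XN_diff[OF \<open>T > 0\<close> u(1) v(1) \<open>m \<ge> 1\<close>])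
  moreover have "nonresonant m a {0..T} (XN m T)" using G unfolding green_function_def by blast
  ultimately have "u t - ?v t = 0"
    using t unfolding nonresonant_def by blast
  then show ?thesis by simp
qed

section \<open>Even and odd extension\<close>

text \<open>\<open>extend T e g\<close> continues \<open>g\<close> from \<open>[0, T]\<close> to \<open>[0, 2T]\<close> evenly (\<open>e = 1\<close>) or oddly
  (\<open>e = - 1\<close>) about \<open>T\<close>.\<close>

definition extend :: "real \<Rightarrow> real \<Rightarrow> (real \<Rightarrow> real) \<Rightarrow> real \<Rightarrow> real" where
  "extend T e g t = (if t \<le> T then g t else e * g (2 * T - t))"

text \<open>The two branches are glued at \<open>T\<close>, and the chain rule gives the reflected
  branch the factor \<open>- e\<close>. Hence values must match under \<open>e\<close> and
  derivatives under \<open>- e\<close>, and differentiation exchanges even and odd extension. The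
  term \<open>min t (2 * T - t)\<close> folds \<open>t\<close> back into
  \<open>{0..T}\<close>.\<close>

lemma extend_has_vector_derivative:
  assumes t: "t \<in> {0..2 * T}"
    and h: "(h has_vector_derivative D) (at (min t (2 * T - t)) within {0..T})"
    and T: "t = T \<Longrightarrow> h T = e * h T \<and> D = - e * D"
  shows "(extend T e h has_vector_derivative (if t \<le> T then D else - e * D)) (at t within {0..2 * T})"
proof -
  let ?r = "\<lambda>x. e * h (2 * T - x)"
  have "0 \<le> T" using t by auto
  have r: "(?r has_vector_derivative - e * D) (at t within {T..2 * T})" if "T \<le> t"
  proof -
    have "(\<lambda>x. 2 * T - x) ` {T..2 * T} = {0..T}" using \<open>0 \<le> T\<close> by simp
    moreover have "min t (2 * T - t) = 2 * T - t" using that by simp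
    ultimately have "(h has_field_derivative D) (at (2 * T - t) within (\<lambda>x. 2 * T - x) ` {T..2 * T})"
      using h by (simp add: has_real_derivative_iff_has_vector_derivative)
    moreover have "((\<lambda>x. 2 * T - x) has_field_derivative -1) (at t within {T..2 * T})"
      by (auto intro!: derivative_eq_intros)
    ultimately have "(h \<circ> (\<lambda>x. 2 * T - x) has_field_derivative D * -1) (at t within {T..2 * T})"
      by (rule DERIV_image_chain)
    from DERIV_cmult[OF this, of e] show ?thesis
      by (simp add: has_real_derivative_iff_has_vector_derivative o_def)
  qed
  \<comment> \<open>Only an inclusion is claimed, since the half-open interval is empty if
    \<open>T = 0\<close>.\<close>
  have "closure {T<..2 * T} \<subseteq> {T..2 * T}" by (rule closure_minimal) auto
  then have cl: "closure {0..T} = {0..T}" "{0..T} \<inter> closure {T<..2 * T} \<subseteq> {T}"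
    by auto
  have "((\<lambda>x. if x \<in> {0..T} then h x else ?r x) has_vector_derivative
      (if t \<in> {0..T} then D else - e * D)) (at t within {0..2 * T})"
  proof (rule has_vector_derivative_If_within_closures[of t "{0..T}" "{T<..2 * T}"])
    show "t \<in> {0..T} \<union> {T<..2 * T}" "{0..2 * T} = {0..T} \<union> {T<..2 * T}"
      using t \<open>0 \<le> T\<close> by auto
    assume "t \<in> {0..T} \<union> closure {0..T} \<inter> closure {T<..2 * T}"
    then have "t \<le> T" using cl by auto
    then have "min t (2 * T - t) = t" by simp
    with h have "(h has_vector_derivative D) (at t within {0..T})" by simp
    then show "(h has_vector_derivative D)
        (at t within {0..T} \<union> closure {0..T} \<inter> closure {T<..2 * T})"
      using cl by (simp add: Un_absorb2 inf.coboundedI1)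
  next
    assume "t \<in> {T<..2 * T} \<union> closure {0..T} \<inter> closure {T<..2 * T}"
    then have "T \<le> t" using cl \<open>0 \<le> T\<close> by auto
    from r[OF this] show "(?r has_vector_derivative - e * D)
        (at t within {T<..2 * T} \<union> closure {0..T} \<inter> closure {T<..2 * T})"
      by (rule has_vector_derivative_within_subset) (use cl \<open>0 \<le> T\<close> in auto)
  next
    assume "t \<in> closure {0..T}" "t \<in> closure {T<..2 * T}"
    then have "t = T" using cl by auto
    then show "h t = ?r t" "D = - e * D" using T by auto
  qed
  moreover have "t \<in> {0..T} \<longleftrightarrow> t \<le> T" using t by auto
  ultimately have "((\<lambda>x. if x \<in> {0..T} then h x else ?r x) has_vector_derivative
      (if t \<le> T then D else - e * D)) (at t within {0..2 * T})"
    by simp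
  then show ?thesis
    using t by (rule has_vector_derivative_transform[rotated 2]) (auto simp: extend_def)
qed

lemma abs_cont_on_extend:
  assumes h: "abs_cont_on {0..T} h" and e: "\<bar>e\<bar> = 1" and hT: "h T = e * h T"
  shows "abs_cont_on {0..2 * T} (extend T e h)"
  unfolding abs_cont_on_def
proof (intro allI impI)
  fix \<epsilon> :: real assume "\<epsilon> > 0"
  then have "\<epsilon> / 2 > 0" by simp
  from h[unfolded abs_cont_on_def, rule_format, OF this]
  obtain d where d: "d > 0" and
    ac: "\<forall>(N::nat) s t. (\<forall>i<N. s i \<le> t i \<and> {s i..t i} \<subseteq> {0..T}) \<and>
        (\<forall>i<N. \<forall>j<N. i \<noteq> j \<longrightarrow> t i \<le> s j \<or> t j \<le> s i) \<and>
        (\<Sum>i<N. t i - s i) < d \<longrightarrow> (\<Sum>i<N. \<bar>h (t i) - h (s i)\<bar>) < \<epsilon> / 2"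
    by blast
  show "\<exists>d>0. \<forall>(N::nat) s t. (\<forall>i<N. s i \<le> t i \<and> {s i..t i} \<subseteq> {0..2 * T}) \<and>
        (\<forall>i<N. \<forall>j<N. i \<noteq> j \<longrightarrow> t i \<le> s j \<or> t j \<le> s i) \<and>
        (\<Sum>i<N. t i - s i) < d \<longrightarrow> (\<Sum>i<N. \<bar>extend T e h (t i) - extend T e h (s i)\<bar>) < \<epsilon>"
  proof (intro exI[of _ d] conjI allI impI d)
    fix N :: nat and s t :: "nat \<Rightarrow> real"
    assume st: "(\<forall>i<N. s i \<le> t i \<and> {s i..t i} \<subseteq> {0..2 * T}) \<and>
        (\<forall>i<N. \<forall>j<N. i \<noteq> j \<longrightarrow> t i \<le> s j \<or> t j \<le> s i) \<and> (\<Sum>i<N. t i - s i) < d"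
    then have st1: "0 \<le> s i \<and> s i \<le> t i \<and> t i \<le> 2 * T" if "i < N" for i
      using that by auto
    have st2: "t i \<le> s j \<or> t j \<le> s i" if "i < N" "j < N" "i \<noteq> j" for i j
      using st that by blast
    \<comment> \<open>Each interval is cut at \<open>T\<close>; the right-hand part is reflected back into \<open>[0, T]\<close>.\<close>
    let ?s1 = "\<lambda>i. min (s i) T" and ?t1 = "\<lambda>i. min (t i) T"
    let ?s2 = "\<lambda>i. 2 * T - max (t i) T" and ?t2 = "\<lambda>i. 2 * T - max (s i) T"
    have le: "(\<Sum>i<N. ?t1 i - ?s1 i) \<le> (\<Sum>i<N. t i - s i)" "(\<Sum>i<N. ?t2 i - ?s2 i) \<le> (\<Sum>i<N. t i - s i)"
      using st1 by (intro sum_mono; fastforce)+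
    have "(\<Sum>i<N. \<bar>h (?t1 i) - h (?s1 i)\<bar>) < \<epsilon> / 2"
    proof (rule ac[THEN spec, of N, THEN spec, of ?s1, THEN spec, of ?t1, THEN mp], intro conjI allI impI)
      fix i assume i: "i < N"
      show "?s1 i \<le> ?t1 i" "{?s1 i..?t1 i} \<subseteq> {0..T}" using st1[OF i] by auto
      fix j assume "j < N" "i \<noteq> j"
      then show "?t1 i \<le> ?s1 j \<or> ?t1 j \<le> ?s1 i" using st2[OF i, of j] by auto
    qed (use le st in linarith)
    moreover have "(\<Sum>i<N. \<bar>h (?t2 i) - h (?s2 i)\<bar>) < \<epsilon> / 2"
    proof (rule ac[THEN spec, of N, THEN spec, of ?s2, THEN spec, of ?t2, THEN mp], intro conjI allI impI)
      fix i assume i: "i < N"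
      show "?s2 i \<le> ?t2 i" "{?s2 i..?t2 i} \<subseteq> {0..T}" using st1[OF i] by auto
      fix j assume "j < N" "i \<noteq> j"
      then show "?t2 i \<le> ?s2 j \<or> ?t2 j \<le> ?s2 i" using st2[OF i, of j] by auto
    qed (use le st in linarith)
    moreover have "(\<Sum>i<N. \<bar>extend T e h (t i) - extend T e h (s i)\<bar>)
        \<le> (\<Sum>i<N. \<bar>h (?t1 i) - h (?s1 i)\<bar> + \<bar>h (?t2 i) - h (?s2 i)\<bar>)"
    proof (rule sum_mono)
      fix i
      \<comment> \<open>One of the two arguments of \<open>h\<close> always equals \<open>T\<close>,
        and its contribution cancels against \<open>h T\<close> by \<open>hT\<close>.\<close>
      have ext: "extend T e h x = h (min x T) + e * h (2 * T - max x T) - h T" for x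
        using hT by (auto simp: extend_def min_def max_def)
      have "extend T e h (t i) - extend T e h (s i)
          = (h (?t1 i) - h (?s1 i)) + - e * (h (?t2 i) - h (?s2 i))"
        unfolding ext by (simp add: algebra_simps)
      moreover have "\<bar>- e * (h (?t2 i) - h (?s2 i))\<bar> = \<bar>h (?t2 i) - h (?s2 i)\<bar>"
        using e by (simp add: abs_mult)
      ultimately show "\<bar>extend T e h (t i) - extend T e h (s i)\<bar>
          \<le> \<bar>h (?t1 i) - h (?s1 i)\<bar> + \<bar>h (?t2 i) - h (?s2 i)\<bar>"
        by linarith
    qed
    ultimately show "(\<Sum>i<N. \<bar>extend T e h (t i) - extend T e h (s i)\<bar>) < \<epsilon>"
      by (simp add: sum.distrib)
  qed
qed

section \<open>Almost everywhere statements and integrals on the doubled interval\<close>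

text \<open>The folding map is the identity or the reflection, so the preimage of a null set lies in
  its union with its mirror image.\<close>

lemma AE_fold:
  fixes T :: real
  assumes "AE t in lebesgue. t \<in> {0..T} \<longrightarrow> P t"
  shows "AE t in lebesgue. t \<in> {0..2 * T} \<longrightarrow> P (min t (2 * T - t))"
proof -
  obtain N where N: "N \<in> null_sets lebesgue" "{t \<in> space lebesgue. \<not> (t \<in> {0..T} \<longrightarrow> P t)} \<subseteq> N"
    using assms unfolding eventually_ae_filter by blast
  have "negligible ((\<lambda>t. 2 * T - t) ` N)"
    using N(1) by (intro negligible_differentiable_image_negligible)
      (auto simp: negligible_iff_null_sets intro!: derivative_intros)
  then have "N \<union> (\<lambda>t. 2 * T - t) ` N \<in> null_sets lebesgue"
    using N(1) by (simp add: negligible_iff_null_sets[symmetric] negligible_Un)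
  then show ?thesis
  proof (rule AE_I')
    show "{t \<in> space lebesgue. \<not> (t \<in> {0..2 * T} \<longrightarrow> P (min t (2 * T - t)))}
        \<subseteq> N \<union> (\<lambda>t. 2 * T - t) ` N"
    proof
      fix t assume "t \<in> {t \<in> space lebesgue. \<not> (t \<in> {0..2 * T} \<longrightarrow> P (min t (2 * T - t)))}"
      then have "min t (2 * T - t) \<in> N" using N(2) by auto
      then show "t \<in> N \<union> (\<lambda>t. 2 * T - t) ` N"
        by (cases "t \<le> 2 * T - t") (auto intro!: image_eqI[of _ _ "2 * T - t"])
    qed
  qed
qed

lemma absolutely_integrable_extend:
  assumes "T \<ge> 0" "\<sigma> absolutely_integrable_on {0..T}"
  shows "extend T e \<sigma> absolutely_integrable_on {0..2 * T}"
proof -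
  have refl: "(\<lambda>t. f (2 * T - t)) integrable_on {T..2 * T}" if "f integrable_on {0..T}"
    for f :: "real \<Rightarrow> real"
  proof -
    from that obtain i where "(f has_integral i) (cbox 0 T)" by (auto simp: integrable_on_def)
    from has_integral_affinity[OF this, of "-1" "2 * T"] show ?thesis
      using \<open>T \<ge> 0\<close> by (auto simp: integrable_on_def algebra_simps)
  qed
  have "(\<lambda>t. \<sigma> (2 * T - t)) absolutely_integrable_on {T..2 * T}"
    using assms(2) refl[of \<sigma>] refl[of "\<lambda>t. norm (\<sigma> t)"] unfolding absolutely_integrable_on_def by simp
  then have "(\<lambda>t. e * \<sigma> (2 * T - t)) absolutely_integrable_on {T..2 * T}"
    by (rule set_integrable_mult_right)
  then have "extend T e \<sigma> absolutely_integrable_on {T..2 * T}"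
    by (rule absolutely_integrable_spike[where S = "{T}"]) (auto simp: extend_def)
  moreover have "extend T e \<sigma> absolutely_integrable_on {0..T}"
    using assms(2) by (rule absolutely_integrable_spike[where S = "{}"]) (auto simp: extend_def)
  ultimately show ?thesis
    using assms(1) by (simp add: absolutely_integrable_on_combine[where c = T])
qed

text \<open>Replacing \<open>g\<close> by the maximum of \<open>f\<close> and \<open>g\<close>
  changes it only on a null set and makes the inequality hold pointwise.\<close>

lemma integral_le_AE:
  fixes f g :: "real \<Rightarrow> real"
  assumes "f integrable_on S" "g integrable_on S" "AE t in lebesgue. t \<in> S \<longrightarrow> f t \<le> g t"
  shows "integral S f \<le> integral S g"
proof -
  obtain N where N: "N \<in> null_sets lebesgue" "{t \<in> space lebesgue. \<not> (t \<in> S \<longrightarrow> f t \<le> g t)} \<subseteq> N"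
    using assms(3) unfolding eventually_ae_filter by blast
  let ?g = "\<lambda>t. max (f t) (g t)"
  have eq: "?g t = g t" if "t \<in> S - N" for t using N(2) that by auto
  have neg: "negligible N" using N(1) by (simp add: negligible_iff_null_sets)
  have "?g integrable_on S" by (rule integrable_spike[OF assms(2) neg eq])
  then have "integral S f \<le> integral S ?g" using assms(1) by (intro integral_le) auto
  also have "\<dots> = integral S g" by (rule integral_spike[OF neg]) (simp add: eq)
  finally show ?thesis .
qed

section \<open>The extended solution of the reflected equation\<close>

context
  fixes m :: nat and T e :: real and u :: "real \<Rightarrow> real"
  assumes T: "T > 0" and e: "\<bar>e\<bar> = 1" and m: "m \<ge> 1" and W: "Wsp m {0..T} u"
    and compat: "\<And>k. k < m \<Longrightarrow> hderiv {0..T} k u T = e * (-1) ^ k * hderiv {0..T} k u T"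
begin

text \<open>Each differentiation flips the parity, hence the factor \<open>(-1) ^ k\<close>. By
  \<open>compat\<close> every derivative that is extended oddly vanishes at \<open>T\<close>, which
  is what gluing requires.\<close>

lemma hderiv_extend:
  assumes "k < m" "t \<in> {0..2 * T}"
  shows "hderiv {0..2 * T} k (extend T e u) t = extend T (e * (-1) ^ k) (hderiv {0..T} k u) t"
  using assms
proof (induction k arbitrary: t)
  case (Suc k)
  let ?s = "min t (2 * T - t)"
  have s: "?s \<in> {0..T}" "t = T \<Longrightarrow> ?s = T" using Suc.prems by auto
  have "(extend T (e * (-1) ^ k) (hderiv {0..T} k u) has_vector_derivative
      (if t \<le> T then hderiv {0..T} (Suc k) u ?s else - (e * (-1) ^ k) * hderiv {0..T} (Suc k) u ?s))
      (at t within {0..2 * T})"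
  proof (rule extend_has_vector_derivative[OF Suc.prems(2)])
    show "(hderiv {0..T} k u has_vector_derivative hderiv {0..T} (Suc k) u ?s) (at ?s within {0..T})"
      using WspD(1)[OF W] s Suc.prems by simp
  qed (use s compat[of k] compat[of "Suc k"] Suc.prems in simp)
  from hderiv_SucI(2)[OF _ Suc.prems(2) Suc.IH this] show ?case
    using T Suc.prems by (auto simp: extend_def)
qed (simp add: extend_def)

text \<open>This pointwise form also reaches \<open>k = m - 1\<close>, where the derivative exists
  only almost everywhere. The point \<open>T\<close> is excluded at that order, because
  \<open>compat\<close> does not constrain the derivative of order \<open>m\<close>.\<close>

lemma hderiv_extend_has_vector_derivative:
  assumes "k < m" "t \<in> {0..2 * T}" "t = T \<Longrightarrow> Suc k < m"
    and "(hderiv {0..T} k u has_vector_derivative hderiv {0..T} (Suc k) u (min t (2 * T - t)))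
            (at (min t (2 * T - t)) within {0..T})"
  shows "(hderiv {0..2 * T} k (extend T e u) has_vector_derivative
            hderiv {0..2 * T} (Suc k) (extend T e u) t) (at t within {0..2 * T})"
    and "hderiv {0..2 * T} (Suc k) (extend T e u) t
       = extend T (e * (-1) ^ Suc k) (hderiv {0..T} (Suc k) u) t"
proof -
  let ?s = "min t (2 * T - t)"
  have s: "t = T \<Longrightarrow> ?s = T" by auto
  have "(extend T (e * (-1) ^ k) (hderiv {0..T} k u) has_vector_derivative
      (if t \<le> T then hderiv {0..T} (Suc k) u ?s else - (e * (-1) ^ k) * hderiv {0..T} (Suc k) u ?s))
      (at t within {0..2 * T})"
    by (rule extend_has_vector_derivative) (use assms s compat[of k] compat[of "Suc k"] in simp_all)
  note * = hderiv_SucI[OF _ assms(2) hderiv_extend[OF assms(1)] this]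
  show "(hderiv {0..2 * T} k (extend T e u) has_vector_derivative
            hderiv {0..2 * T} (Suc k) (extend T e u) t) (at t within {0..2 * T})"
    using * T by simp
  show "hderiv {0..2 * T} (Suc k) (extend T e u) t
       = extend T (e * (-1) ^ Suc k) (hderiv {0..T} (Suc k) u) t"
    using *(2) T by (auto simp: extend_def)
qed

lemma Wsp_extend: "Wsp m {0..2 * T} (extend T e u)"
proof -
  have d: "(hderiv {0..2 * T} k (extend T e u) has_vector_derivative
            hderiv {0..2 * T} (Suc k) (extend T e u) t) (at t within {0..2 * T})"
    if "Suc k < m" "t \<in> {0..2 * T}" for k t
  proof (rule hderiv_extend_has_vector_derivative)
    have "min t (2 * T - t) \<in> {0..T}" using that by auto
    then show "(hderiv {0..T} k u has_vector_derivative hderiv {0..T} (Suc k) u (min t (2 * T - t)))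
            (at (min t (2 * T - t)) within {0..T})"
      using WspD(1)[OF W] that by simp
  qed (use that in auto)
  have top: "m - 1 < m" using m by simp
  have c: "continuous_on {0..2 * T} (hderiv {0..2 * T} k (extend T e u))" if "k < m" for k
  proof -
    have h: "continuous_on {0..T} (hderiv {0..T} k u)" using WspD(2)[OF W] that by simp
    have "continuous_on ({0..T} \<union> {T..2 * T})
        (\<lambda>t. if t \<le> T then hderiv {0..T} k u t else e * (-1) ^ k * hderiv {0..T} k u (2 * T - t))"
    proof (rule continuous_on_If)
      show "continuous_on {T..2 * T} (\<lambda>t. e * (-1) ^ k * hderiv {0..T} k u (2 * T - t))"
        by (intro continuous_intros continuous_on_compose2[OF h]) auto
    qed (use h compat[OF that] in auto)
    moreover have "{0..T} \<union> {T..2 * T} = {0..2 * T}" using T by auto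
    ultimately have "continuous_on {0..2 * T} (extend T (e * (-1) ^ k) (hderiv {0..T} k u))"
      by (simp add: extend_def[abs_def])
    then show ?thesis by (rule continuous_on_eq) (simp add: hderiv_extend[OF that])
  qed
  have "abs_cont_on {0..2 * T} (hderiv {0..2 * T} (m - 1) (extend T e u))"
  proof (rule abs_cont_on_cong[OF abs_cont_on_extend hderiv_extend[OF top]])
    show "abs_cont_on {0..T} (hderiv {0..T} (m - 1) u)" by (rule WspD(3)[OF W])
    show "\<bar>e * (-1) ^ (m - 1)\<bar> = 1" using e by (simp add: abs_mult power_abs)
  qed (use compat[OF top] in simp)
  with d c show ?thesis unfolding Wsp_def by blast
qed

text \<open>The sign \<open>(-1) ^ k\<close> of the reflected coefficient cancels that of the
  derivative of order \<open>k\<close>, and the top sign is 1 for even \<open>m\<close>. So the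
  reflected operator maps the extension of \<open>u\<close> to the extension of
  \<open>\<sigma>\<close> with the same \<open>e\<close>.\<close>

lemma solves_ae_extend:
  assumes "even m" "solves_ae m a {0..T} \<sigma> u"
  shows "solves_ae m (refl_coeff T a) {0..2 * T} (extend T e \<sigma>) (extend T e u)"
proof -
  have "{T} \<in> null_sets lebesgue" by (simp add: negligible_iff_null_sets[symmetric])
  then have "AE t in lebesgue. t \<noteq> T" by (rule AE_I') auto
  with AE_fold[OF assms(2)[unfolded solves_ae_def]] AE_fold[OF Wsp_top_derivative_ae[OF W m]]
  show ?thesis
    unfolding solves_ae_def
  proof eventually_elim
    case (elim t)
    show ?case
    proof
      assume t: "t \<in> {0..2 * T}"
      let ?s = "min t (2 * T - t)"
      have L: "hderiv {0..T} m u ?s + (\<Sum>k<m. a k ?s * hderiv {0..T} k u ?s) = \<sigma> ?s"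
        using elim t by (simp add: Lop_def)
      have "m - 1 < m" "Suc (m - 1) = m" using m by auto
      then have "hderiv {0..2 * T} m (extend T e u) t = extend T (e * (-1) ^ m) (hderiv {0..T} m u) t"
        using hderiv_extend_has_vector_derivative(2)[of "m - 1" t] elim t by simp
      then have top: "hderiv {0..2 * T} m (extend T e u) t = extend T e (hderiv {0..T} m u) t"
        using \<open>even m\<close> by simp
      have s1: "(-1) ^ k * x * (e * (-1) ^ k * y) = e * (x * y)" for x y :: real and k
        by (simp add: power_mult_distrib[symmetric] mult.assoc mult.left_commute)
      have "(\<Sum>k<m. refl_coeff T a k t * hderiv {0..2 * T} k (extend T e u) t)
          = (\<Sum>k<m. (if t \<le> T then 1 else e) * (a k ?s * hderiv {0..T} k u ?s))"
        using hderiv_extend[OF _ t] by (intro sum.cong) (auto simp: refl_coeff_def extend_def s1)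
      also have "\<dots> = (if t \<le> T then 1 else e) * (\<Sum>k<m. a k ?s * hderiv {0..T} k u ?s)"
        by (simp add: sum_distrib_left)
      finally have "Lop m (refl_coeff T a) {0..2 * T} (extend T e u) t
          = (if t \<le> T then 1 else e) * \<sigma> ?s"
        unfolding Lop_def top L[symmetric] by (auto simp: extend_def distrib_left)
      then show "Lop m (refl_coeff T a) {0..2 * T} (extend T e u) t = extend T e \<sigma> t"
        by (auto simp: extend_def)
    qed
  qed
qed

text \<open>The conditions at \<open>2 * T\<close> are mirror images of those at 0; the conditions
  at \<open>T\<close> have been absorbed into \<open>compat\<close>.\<close>

lemma XN_extend:
  assumes "\<And>k. k < m div 2 \<Longrightarrow> hderiv {0..T} (2 * k + 1) u 0 = 0"
  shows "XN m (2 * T) (extend T e u)"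
  unfolding XN_def
proof (intro conjI allI impI Wsp_extend)
  fix k assume k: "k < m div 2"
  then have "2 * k + 1 < m" by simp
  from hderiv_extend[OF this, of 0] hderiv_extend[OF this, of "2 * T"] assms[OF k] T
  show "hderiv {0..2 * T} (2 * k + 1) (extend T e u) 0 = 0"
    "hderiv {0..2 * T} (2 * k + 1) (extend T e u) (2 * T) = 0"
    by (simp_all add: extend_def)
qed

end

section \<open>Comparison of the solutions\<close>

theorem theorem6p4:
  fixes n :: nat and T \<alpha> :: real and a :: "nat \<Rightarrow> real \<Rightarrow> real"
    and \<sigma>1 \<sigma>2 uN uM :: "real \<Rightarrow> real" and G2 :: "real \<Rightarrow> real \<Rightarrow> real"
  assumes n: "n \<ge> 1" and T: "T > 0" and \<alpha>: "\<alpha> \<ge> 1"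
    and coeffs: "\<forall>k < 2*n. in_Lp \<alpha> {0..T} (a k)"
    and G2: "green_function (2*n) (refl_coeff T a) {0..2*T} (XN (2*n) (2*T)) G2"
    and GN: "\<exists>G. green_function (2*n) a {0..T} (XN (2*n) T) G"
    and GM: "\<exists>G. green_function (2*n) a {0..T} (XM1 (2*n) T) G"
    and \<sigma>1: "\<sigma>1 absolutely_integrable_on {0..T}"
    and \<sigma>2: "\<sigma>2 absolutely_integrable_on {0..T}"
    and uN: "XN (2*n) T uN" "solves_ae (2*n) a {0..T} \<sigma>1 uN"
    and uM: "XM1 (2*n) T uM" "solves_ae (2*n) a {0..T} \<sigma>2 uM"
  shows "((\<forall>t\<in>{0..2*T}. \<forall>s\<in>{0..2*T}. G2 t s \<ge> 0) \<and>
            (AE t in lebesgue. t \<in> {0..T} \<longrightarrow> \<bar>\<sigma>2 t\<bar> \<le> \<sigma>1 t)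
            \<longrightarrow> (\<forall>t\<in>{0..T}. \<bar>uM t\<bar> \<le> uN t))
       \<and> ((\<forall>t\<in>{0..2*T}. \<forall>s\<in>{0..2*T}. G2 t s \<le> 0) \<and>
            (AE t in lebesgue. t \<in> {0..T} \<longrightarrow> 0 \<le> \<sigma>2 t \<and> \<sigma>2 t \<le> \<sigma>1 t)
            \<longrightarrow> (\<forall>t\<in>{0..T}. uN t \<le> 0 \<and> uN t \<le> uM t))
       \<and> ((\<forall>t\<in>{0..2*T}. \<forall>s\<in>{0..2*T}. G2 t s \<le> 0) \<and>
            (AE t in lebesgue. t \<in> {0..T} \<longrightarrow> \<sigma>1 t \<le> \<sigma>2 t \<and> \<sigma>2 t \<le> 0)
            \<longrightarrow> (\<forall>t\<in>{0..T}. uN t \<ge> 0 \<and> uM t \<le> uN t))"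
proof -
  let ?J = "{0..2*T}" and ?m = "2 * n"
  let ?s1 = "extend T 1 \<sigma>1" and ?s2 = "extend T (-1) \<sigma>2"
  have m: "?m \<ge> 1" "even ?m" and T2: "2 * T > 0" using n T by auto
  have parity: "(\<exists>j. k = 2 * j \<and> j < ?m div 2) \<or> (\<exists>j. k = 2 * j + 1 \<and> j < ?m div 2)"
    if "k < ?m" for k
    using that by presburger
  have WN: "Wsp ?m {0..T} uN" using uN(1) unfolding XN_def by blast
  have WM: "Wsp ?m {0..T} uM" using uM(1) unfolding XM1_def by blast
  \<comment> \<open>The Neumann conditions at \<open>T\<close> annihilate the odd orders, as the
    even extension requires; the mixed conditions below annihilate the even orders for the odd
    extension.\<close>
  have cN: "hderiv {0..T} k uN T = 1 * (-1) ^ k * hderiv {0..T} k uN T" if "k < ?m" for k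
    using parity[OF that] uN(1) unfolding XN_def by auto
  have cM: "hderiv {0..T} k uM T = -1 * (-1) ^ k * hderiv {0..T} k uM T" if "k < ?m" for k
    using parity[OF that] uM(1) unfolding XM1_def by auto
  have I1: "?s1 absolutely_integrable_on ?J" and I2: "?s2 absolutely_integrable_on ?J"
    using absolutely_integrable_extend \<sigma>1 \<sigma>2 T by simp_all
  have uN_eq: "uN t = integral ?J (\<lambda>s. G2 t s * ?s1 s)" if t: "t \<in> {0..T}" for t
  proof -
    have "extend T 1 uN t = integral ?J (\<lambda>s. G2 t s * ?s1 s)"
    proof (rule green_function_XN_represents[OF G2 T2 m(1) I1])
      show "XN ?m (2 * T) (extend T 1 uN)"
        using uN(1) by (intro XN_extend[OF T _ m(1) WN cN]) (auto simp: XN_def)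
      show "solves_ae ?m (refl_coeff T a) ?J ?s1 (extend T 1 uN)"
        by (rule solves_ae_extend[OF T _ m(1) WN cN m(2) uN(2)]) auto
    qed (use t in auto)
    then show ?thesis using t by (simp add: extend_def)
  qed
  have uM_eq: "uM t = integral ?J (\<lambda>s. G2 t s * ?s2 s)" if t: "t \<in> {0..T}" for t
  proof -
    have "extend T (-1) uM t = integral ?J (\<lambda>s. G2 t s * ?s2 s)"
    proof (rule green_function_XN_represents[OF G2 T2 m(1) I2])
      show "XN ?m (2 * T) (extend T (-1) uM)"
        using uM(1) by (intro XN_extend[OF T _ m(1) WM cM]) (auto simp: XM1_def)
      show "solves_ae ?m (refl_coeff T a) ?J ?s2 (extend T (-1) uM)"
        by (rule solves_ae_extend[OF T _ m(1) WM cM m(2) uM(2)]) auto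
    qed (use t in auto)
    then show ?thesis using t by (simp add: extend_def)
  qed
  have int: "(\<lambda>s. G2 t s * ?s1 s) integrable_on ?J" "(\<lambda>s. G2 t s * ?s2 s) integrable_on ?J"
    if "t \<in> {0..T}" for t
  proof -
    have "t \<in> ?J" using that by auto
    with G2 I1 I2 show "(\<lambda>s. G2 t s * ?s1 s) integrable_on ?J" "(\<lambda>s. G2 t s * ?s2 s) integrable_on ?J"
      unfolding green_function_def by blast+
  qed
  \<comment> \<open>By folding, a hypothesis \<open>P\<close> on \<open>{0..T}\<close> holds at the
    folded point of almost every \<open>s\<close> in \<open>?J\<close>, so both branches of the
    extensions are compared by one condition.\<close>
  have le: "integral ?J f \<le> integral ?J g"
    if "f integrable_on ?J" "g integrable_on ?J"
      and "AE s in lebesgue. s \<in> {0..T} \<longrightarrow> P s"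
      and "\<And>s. s \<in> ?J \<Longrightarrow> P (min s (2 * T - s)) \<Longrightarrow> f s \<le> g s"
    for f g :: "real \<Rightarrow> real" and P
    by (rule integral_le_AE[OF that(1,2)]) (use AE_fold[OF that(3)] that(4) in \<open>auto elim!: eventually_mono\<close>)
  show ?thesis
  proof (intro conjI impI ballI; elim conjE)
    fix t assume t: "t \<in> {0..T}" and G: "\<forall>t\<in>?J. \<forall>s\<in>?J. G2 t s \<ge> 0"
      and ae: "AE t in lebesgue. t \<in> {0..T} \<longrightarrow> \<bar>\<sigma>2 t\<bar> \<le> \<sigma>1 t"
    have G0: "G2 t s \<ge> 0" if "s \<in> ?J" for s using G t that by auto
    note i = int[OF t]
    \<comment> \<open>The bound on \<bar>\<sigma>2\<bar> controls both signs, so the odd extension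
      \<open>?s2\<close> and its negative lie below the even extension \<open>?s1\<close> on both
      halves.\<close>
    have "uM t \<le> uN t"
      unfolding uM_eq[OF t] uN_eq[OF t] using i(2,1) ae
      by (rule le) (intro mult_left_mono G0, auto simp: extend_def min_def split: if_splits)
    moreover have "- uM t \<le> uN t"
      unfolding uM_eq[OF t] uN_eq[OF t] integral_neg[symmetric] using integrable_neg[OF i(2)] i(1) ae
      by (rule le) (subst mult_minus_right[symmetric], intro mult_left_mono G0,
          auto simp: extend_def min_def split: if_splits)
    ultimately show "\<bar>uM t\<bar> \<le> uN t" by linarith
  next
    fix t assume t: "t \<in> {0..T}" and G: "\<forall>t\<in>?J. \<forall>s\<in>?J. G2 t s \<le> 0"
      and ae: "AE t in lebesgue. t \<in> {0..T} \<longrightarrow> 0 \<le> \<sigma>2 t \<and> \<sigma>2 t \<le> \<sigma>1 t"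
    have G0: "G2 t s \<le> 0" if "s \<in> ?J" for s using G t that by auto
    note i = int[OF t]
    have "integral ?J (\<lambda>s. G2 t s * ?s1 s) \<le> integral ?J (\<lambda>s. 0)"
      using i(1) integrable_0 ae
      by (rule le) (intro mult_nonpos_nonneg G0, auto simp: extend_def min_def split: if_splits)
    then show "uN t \<le> 0" using uN_eq[OF t] by simp
    \<comment> \<open>On the right half \<open>?s2\<close> is a reflected
      \<open>- \<sigma>2\<close>, which is at most 0 and hence at most \<open>?s1\<close>.
      Multiplication by the nonpositive kernel reverses the inequality.\<close>
    show "uN t \<le> uM t"
      unfolding uM_eq[OF t] uN_eq[OF t] using i ae
      by (rule le) (intro mult_left_mono_neg G0, auto simp: extend_def min_def split: if_splits)
  next
    fix t assume t: "t \<in> {0..T}" and G: "\<forall>t\<in>?J. \<forall>s\<in>?J. G2 t s \<le> 0"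
      and ae: "AE t in lebesgue. t \<in> {0..T} \<longrightarrow> \<sigma>1 t \<le> \<sigma>2 t \<and> \<sigma>2 t \<le> 0"
    have G0: "G2 t s \<le> 0" if "s \<in> ?J" for s using G t that by auto
    note i = int[OF t]
    have "integral ?J (\<lambda>s. 0) \<le> integral ?J (\<lambda>s. G2 t s * ?s1 s)"
      using integrable_0 i(1) ae
      by (rule le) (intro mult_nonpos_nonpos G0, auto simp: extend_def min_def split: if_splits)
    then show "0 \<le> uN t" using uN_eq[OF t] by simp
    \<comment> \<open>Here \<open>?s1 \<le> ?s2\<close>: on the right half,
      \<open>\<sigma>1 \<le> 0 \<le> - \<sigma>2\<close> at the reflected point.\<close>
    show "uM t \<le> uN t"
      unfolding uM_eq[OF t] uN_eq[OF t] using i(2,1) ae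
      by (rule le) (intro mult_left_mono_neg G0, auto simp: extend_def min_def split: if_splits)
  qed
qed

end
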